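(* Let $m,p,n\geq1$, $T>0$, let $\mathcal{A}_1,\dots,\mathcal{A}_n\in\mathbb{C}^{m\times m\times p}$ be fixed Hermitian T-product tensors, and let $\mathcal{X}_1,\dots,\mathcal{X}_n\in\mathbb{C}^{m\times m\times p}$ be independent random Hermitian T-product tensors such that for each $i$, $$\mathbb{E}\mathcal{X}_i=\mathcal{O}\quad\text{and}\quad\mathbb{E}(\mathcal{X}_i^k)\preceq\frac{k!\,T^{k-2}}{2}\mathcal{A}_i^2\quad\text{for all }k=2,3,4,\dots.$$ Let $\sigma^2=\left\Vert\sum_{i=1}^n\mathcal{A}_i^2\right\Vert$. Then for $\theta\ge0$, $$\Pr\left(\lambda_{\max}\left(\sum_{i=1}^n\mathcal{X}_i\right)\geq\theta\right)\leq mp\exp\left(\frac{-\theta^2/2}{\sigma^2+T\theta}\right);$$ moreover $$\Pr\left(\lambda_{\max}\left(\sum_{i=1}^n\mathcal{X}_i\right)\geq\theta\right)\leq mp\exp\left(\frac{-\theta^2}{4\sigma^2}\right)\quad\text{for }\theta\leq\sigma^2/T,$$ and $$\Pr\left(\lambda_{\max}\left(\sum_{i=1}^n\mathcal{X}_i\right)\geq\theta\right)\leq mp\exp\left(\frac{-\theta}{4T}\right)\quad\text{for }\theta\geq\sigma^2/T.$$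
   Context: For $\mathcal{A}\in\mathbb{C}^{m\times n\times p}$ with frontal slices $A^{(1)},\dots,A^{(p)}$, $\mathrm{bcirc}(\mathcal{A})\in\mathbb{C}^{mp\times np}$ is the block circulant matrix whose $(r,s)$ block is $A^{(((r-s)\bmod p)+1)}$. The T-product $\mathcal{A}\star\mathcal{B}$ is the tensor with $\mathrm{bcirc}(\mathcal{A}\star\mathcal{B})=\mathrm{bcirc}(\mathcal{A})\mathrm{bcirc}(\mathcal{B})$; powers $\mathcal{A}^k$ are T-product powers. The conjugate transpose $\mathcal{A}^{\mathrm H}$ is obtained by conjugate-transposing every frontal slice and reversing the order of slices $2,\dots,p$. $\mathcal{A}\in\mathbb{C}^{m\times m\times p}$ is Hermitian if $\mathcal{A}^{\mathrm H}=\mathcal{A}$; its eigenvalues are the $mp$ eigenvalues of $\mathrm{bcirc}(\mathcal{A})$, with largest $\lambda_{\max}$. For Hermitian $\mathcal{A},\mathcal{B}$, $\mathcal{A}\preceq\mathcal{B}$ means $\mathrm{bcirc}(\mathcal{B}-\mathcal{A})$ is positive semidefinite. $\Vert\mathcal{A}\Vert$ is the largest singular value of $\mathrm{bcirc}(\mathcal{A})$. $\mathcal{O}$ is the zero tensor; expectation is entrywise. *)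

theory Defs
  imports "HOL-Probability.Probability" "Jordan_Normal_Form.Char_Poly"
begin

text \<open>A third-order tensor in C^(m x m x p) (or m x n x p) is represented as a function
  A i j k = entry (i,j) of the frontal slice k+1 (0-based indices i<m, j<n, k<p).
  Entries outside the index range are irrelevant junk.\<close>

type_synonym tensor = "nat \<Rightarrow> nat \<Rightarrow> nat \<Rightarrow> complex"

definition bcirc :: "nat \<Rightarrow> nat \<Rightarrow> nat \<Rightarrow> tensor \<Rightarrow> complex mat" where
  "bcirc m n p A = mat (m*p) (n*p)
     (\<lambda>(r,s). A (r mod m) (s mod n) ((r div m + p - s div n) mod p))"

text \<open>T-product of an m x q x p and a q x n x p tensor, so that
  bcirc (A * B) = bcirc A * bcirc B.\<close>
definition tprod :: "nat \<Rightarrow> nat \<Rightarrow> tensor \<Rightarrow> tensor \<Rightarrow> tensor" where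
  "tprod q p A B = (\<lambda>i j k. \<Sum>l<p. \<Sum>t<q. A i t ((k + p - l) mod p) * B t j l)"

definition tid :: tensor where
  "tid = (\<lambda>i j k. if i = j \<and> k = 0 then 1 else 0)"

fun tpow :: "nat \<Rightarrow> nat \<Rightarrow> tensor \<Rightarrow> nat \<Rightarrow> tensor" where
  "tpow m p A 0 = tid"
| "tpow m p A (Suc k) = tprod m p A (tpow m p A k)"

definition tzero :: tensor where "tzero = (\<lambda>i j k. 0)"

definition tscale :: "complex \<Rightarrow> tensor \<Rightarrow> tensor" where
  "tscale c A = (\<lambda>i j k. c * A i j k)"

definition tsum :: "(nat \<Rightarrow> tensor) \<Rightarrow> nat set \<Rightarrow> tensor" where
  "tsum F I = (\<lambda>i j k. \<Sum>l\<in>I. F l i j k)"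

definition tminus :: "tensor \<Rightarrow> tensor \<Rightarrow> tensor" where
  "tminus A B = (\<lambda>i j k. A i j k - B i j k)"

definition tconj :: "nat \<Rightarrow> tensor \<Rightarrow> tensor" where
  "tconj p A = (\<lambda>i j k. cnj (A j i ((p - k) mod p)))"

definition thermitian :: "nat \<Rightarrow> nat \<Rightarrow> tensor \<Rightarrow> bool" where
  "thermitian m p A \<longleftrightarrow> (\<forall>i<m. \<forall>j<m. \<forall>k<p. tconj p A i j k = A i j k)"

definition mat_ctrans :: "complex mat \<Rightarrow> complex mat" where
  "mat_ctrans B = mat (dim_col B) (dim_row B) (\<lambda>(i,j). cnj (B $$ (j,i)))"

definition psd :: "complex mat \<Rightarrow> bool" where
  "psd B \<longleftrightarrow> (\<exists>N. B \<in> carrier_mat N N \<and> mat_ctrans B = B \<and>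
     (\<forall>v :: nat \<Rightarrow> complex. 0 \<le> Re (\<Sum>i<N. \<Sum>j<N. cnj (v i) * B $$ (i,j) * v j)))"

definition tle :: "nat \<Rightarrow> nat \<Rightarrow> tensor \<Rightarrow> tensor \<Rightarrow> bool" where
  "tle m p A B \<longleftrightarrow> psd (bcirc m m p (tminus B A))"

definition lambda_max :: "nat \<Rightarrow> nat \<Rightarrow> tensor \<Rightarrow> real" where
  "lambda_max m p A = Max (Re ` {z. eigenvalue (bcirc m m p A) z})"

definition tnorm :: "nat \<Rightarrow> nat \<Rightarrow> nat \<Rightarrow> tensor \<Rightarrow> real" where
  "tnorm m n p A = sqrt (Max (Re ` {z. eigenvalue
      (mat_ctrans (bcirc m n p A) * bcirc m n p A) z}))"

definition texp :: "'a measure \<Rightarrow> ('a \<Rightarrow> tensor) \<Rightarrow> tensor" where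
  "texp M Y = (\<lambda>i j k. integral\<^sup>L M (\<lambda>\<omega>. Y \<omega> i j k))"

definition tidx :: "nat \<Rightarrow> nat \<Rightarrow> (nat \<times> nat \<times> nat) set" where
  "tidx m p = {..<m} \<times> {..<m} \<times> {..<p}"

definition tensor_space :: "nat \<Rightarrow> nat \<Rightarrow> (nat \<times> nat \<times> nat \<Rightarrow> complex) measure" where
  "tensor_space m p = PiM (tidx m p) (\<lambda>_. borel)"

definition tentries :: "nat \<Rightarrow> nat \<Rightarrow> tensor \<Rightarrow> (nat \<times> nat \<times> nat \<Rightarrow> complex)" where
  "tentries m p A = restrict (\<lambda>(i,j,k). A i j k) (tidx m p)"

end

theory Submission
  imports Defs
begin

text \<open>By the Laplace transform method, it suffices to bound \<open>E tr exp (t \<Sum> X i)\<close> by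
  \<open>tr exp (g \<Sum> (A i)\<^sup>2)\<close> with \<open>g = t\<^sup>2 / (2 (1 - t T))\<close>. The moment hypothesis gives
  \<open>E exp (t X i) \<le> 1 + g (A i)\<^sup>2 \<le> exp (g (A i)\<^sup>2)\<close> in the Loewner order, and the summands are
  exchanged one at a time by the following consequence of Lieb's theorem: if \<open>E exp R \<le> exp G\<close>, then
  \<open>E tr exp (H + R) \<le> tr exp (H + G)\<close>. The latter is proved without operator monotonicity or
  concavity of the logarithm, from Gibbs' variational principle for \<open>tr exp\<close> and from linear functionals
  supporting the relative entropy, i.e. from its joint convexity.\<close>

section \<open>Spectral theorem for Hermitian matrices\<close>

text \<open>Write D(F|Y) = tr (F ln F - F ln Y - F + Y). Gibbs' principle for the exponent H + ln Y
  says that tr exp (H + ln Y) is the maximum over positive F of tr (F H) + tr Y - D(F|Y), attained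
  at F = exp (H + ln Y). Joint convexity of D is therefore what permits averaging over Y = exp R.
  Only E exp R \<le> exp G is available, not equality; the usual remedy, operator monotonicity of
  the logarithm, is replaced by a property of the supporting functional: its coefficient in Y is at
  most the identity, so tr Y minus that part is monotone in Y. A second obstacle is integrability.
  The moments are bounded from one side only, which says nothing about the absolute size of odd
  powers; the exponential series is dominated by its even powers, which are positive semidefinite.
  In the nondegenerate case t = \<theta> / (\<sigma>2 + T \<theta>), so that 1 - t T = \<sigma>2 /
  (\<sigma>2 + T \<theta>) and the exponent collapses to the claimed one.\<close>

text \<open>Matrices of size \<open>N\<close> are functions of two indices; entries with an index \<open>\<ge> N\<close> are junk. The
  size is thus an ordinary number, and sums of matrices need no carrier conditions.\<close>

type_synonym cvec = "nat \<Rightarrow> complex"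
type_synonym cmat = "nat \<Rightarrow> nat \<Rightarrow> complex"

section \<open>Inner products and matrix-vector products\<close>

definition ip :: "nat \<Rightarrow> cvec \<Rightarrow> cvec \<Rightarrow> complex" where
  "ip N x y = (\<Sum>a<N. cnj (x a) * y a)"

definition mv :: "nat \<Rightarrow> cmat \<Rightarrow> cvec \<Rightarrow> cvec" where
  "mv N A x = (\<lambda>a. \<Sum>b<N. A a b * x b)"

definition herm :: "nat \<Rightarrow> cmat \<Rightarrow> bool" where
  "herm N A \<longleftrightarrow> (\<forall>a<N. \<forall>b<N. A b a = cnj (A a b))"

lemma hermD: "herm N A \<Longrightarrow> a < N \<Longrightarrow> b < N \<Longrightarrow> cnj (A a b) = A b a"
  by (metis herm_def)

lemma ip_cong: "(\<And>a. a < N \<Longrightarrow> x a = x' a) \<Longrightarrow> (\<And>a. a < N \<Longrightarrow> y a = y' a) \<Longrightarrow> ip N x y = ip N x' y'"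
  by (simp add: ip_def)

lemma ip_cnj: "cnj (ip N x y) = ip N y x"
  by (simp add: ip_def mult.commute)

lemma ip_add_right: "ip N x (\<lambda>a. y a + z a) = ip N x y + ip N x z"
  and ip_diff_right: "ip N x (\<lambda>a. y a - z a) = ip N x y - ip N x z"
  and ip_scale_right: "ip N x (\<lambda>a. c * y a) = c * ip N x y"
  and ip_add_left: "ip N (\<lambda>a. y a + z a) x = ip N y x + ip N z x"
  and ip_diff_left: "ip N (\<lambda>a. y a - z a) x = ip N y x - ip N z x"
  and ip_scale_left: "ip N (\<lambda>a. c * y a) x = cnj c * ip N y x"
  by (simp_all add: ip_def algebra_simps sum.distrib sum_subtractf sum_distrib_left)

lemma ip_sum_right: "ip N x (\<lambda>a. \<Sum>i\<in>I. f i a) = (\<Sum>i\<in>I. ip N x (f i))"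
  unfolding ip_def sum_distrib_left by (rule sum.swap)

lemma ip_sum_left: "ip N (\<lambda>a. \<Sum>i\<in>I. f i a) x = (\<Sum>i\<in>I. ip N (f i) x)"
  unfolding ip_def cnj_sum sum_distrib_right by (rule sum.swap)

lemma ip_self: "ip N x x = of_real (\<Sum>a<N. (cmod (x a))\<^sup>2)"
  by (simp add: ip_def complex_norm_square mult.commute del: of_real_power)

lemma ip_self_nonneg: "0 \<le> Re (ip N x x)"
  by (simp add: ip_self sum_nonneg)

lemma ip_self_eq_0: "Re (ip N x x) = 0 \<longleftrightarrow> (\<forall>a<N. x a = 0)"
  by (auto simp: ip_self sum_nonneg_eq_0_iff)

lemma mv_diff_right: "mv N A (\<lambda>a. x a - y a) = (\<lambda>a. mv N A x a - mv N A y a)"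
  and mv_scale_right: "mv N A (\<lambda>a. c * x a) = (\<lambda>a. c * mv N A x a)"
  by (simp_all add: mv_def algebra_simps sum.distrib sum_subtractf sum_distrib_left)

lemma mv_cong: "(\<And>b. b < N \<Longrightarrow> x b = y b) \<Longrightarrow> mv N A x = mv N A y"
  by (simp add: mv_def)

lemma herm_ip:
  assumes "herm N A"
  shows "ip N x (mv N A y) = ip N (mv N A x) y"
proof -
  have "ip N x (mv N A y) = (\<Sum>a<N. \<Sum>b<N. cnj (x a) * (A a b * y b))"
    by (simp add: ip_def mv_def sum_distrib_left)
  also have "\<dots> = (\<Sum>b<N. \<Sum>a<N. cnj (x a) * (A a b * y b))"
    by (rule sum.swap)
  also have "\<dots> = (\<Sum>b<N. \<Sum>a<N. cnj (A b a * x a) * y b)"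
    by (intro sum.cong refl) (simp add: hermD[OF assms])
  also have "\<dots> = ip N (mv N A x) y"
    by (simp add: ip_def mv_def sum_distrib_right)
  finally show ?thesis .
qed

section \<open>Eigenvectors as constrained maximisers of the quadratic form\<close>

lemma unit_vector_norm: "ip N x x = 1 \<Longrightarrow> (\<Sum>a<N. (cmod (x a))\<^sup>2) = 1"
  unfolding ip_self by (metis of_real_1 of_real_eq_iff)

text \<open>Vectors are functions on all naturals with the product topology. Setting the entries
  past \<open>N\<close> to zero places the unit sphere inside a product of closed unit discs,
  compact by Tychonoff, in which it is closed.\<close>

lemma compact_unit_orthogonal:
  "compact {x::cvec. (\<forall>i\<ge>N. x i = 0) \<and> ip N x x = 1 \<and> (\<forall>i<k. ip N (u i) x = 0)}" (is "compact ?K")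
proof -
  have P: "compact (PiE UNIV (\<lambda>_::nat. cball (0::complex) 1))"
    using compactin_PiE[of "\<lambda>_. euclidean" UNIV "\<lambda>_::nat. cball (0::complex) 1"]
    by (simp add: euclidean_product_topology)
  have sub: "?K \<subseteq> PiE UNIV (\<lambda>_::nat. cball (0::complex) 1)"
  proof
    fix x assume x: "x \<in> ?K"
    have "cmod (x i) \<le> 1" for i
    proof (cases "i < N")
      case True
      have "(\<Sum>a<N. (cmod (x a))\<^sup>2) = 1"
        using x by (intro unit_vector_norm) simp
      moreover have "(cmod (x i))\<^sup>2 \<le> (\<Sum>a<N. (cmod (x a))\<^sup>2)"
        using True by (intro member_le_sum) auto
      ultimately show ?thesis
        by (simp add: power_le_one_iff abs_square_le_1)
    next
      case False
      then show ?thesis using x by simp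
    qed
    then show "x \<in> PiE UNIV (\<lambda>_::nat. cball (0::complex) 1)"
      by (simp add: PiE_def)
  qed
  have cl: "closed ?K"
  proof -
    have c: "continuous_on UNIV (\<lambda>x::cvec. x i)" for i
      by simp
    have "closed {x::cvec. x i = 0}" for i
      by (intro closed_Collect_eq c continuous_intros)
    moreover have "closed {x::cvec. ip N x x = 1}"
      unfolding ip_def by (intro closed_Collect_eq c continuous_intros)
    moreover have "closed {x::cvec. ip N (u i) x = 0}" for i
      unfolding ip_def by (intro closed_Collect_eq c continuous_intros)
    moreover have "?K = (\<Inter>i\<in>{N..}. {x. x i = 0}) \<inter> {x. ip N x x = 1} \<inter> (\<Inter>i\<in>{..<k}. {x. ip N (u i) x = 0})"
      by auto
    ultimately show ?thesis
      by (simp only:) (intro closed_Int closed_INT; simp)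
  qed
  show ?thesis
    using compact_Int_closed[OF P cl] by (simp only: inf_absorb2[OF sub])
qed

lemma normalize_vector:
  assumes "Re (ip N y y) \<noteq> 0"
  obtains s z where "s > 0" "ip N y y = of_real (s\<^sup>2)" "ip N z z = 1"
    "\<And>b. b < N \<Longrightarrow> z b = of_real (1 / s) * y b" "\<And>b. b \<ge> N \<Longrightarrow> z b = 0"
proof
  define s where "s = sqrt (Re (ip N y y))"
  define z where "z = (\<lambda>b. if b < N then of_real (1 / s) * y b else 0)"
  show s: "s > 0" "ip N y y = of_real (s\<^sup>2)"
    using assms ip_self_nonneg[of N y] by (simp_all add: s_def ip_self)
  have "ip N z z = ip N (\<lambda>b. of_real (1 / s) * y b) (\<lambda>b. of_real (1 / s) * y b)"
    by (rule ip_cong) (simp_all add: z_def)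
  also have "\<dots> = of_real (1 / s) * (of_real (1 / s) * of_real (s\<^sup>2))"
    by (simp only: ip_scale_left ip_scale_right s complex_cnj_complex_of_real)
  also have "\<dots> = 1"
    using s by (simp add: power2_eq_square)
  finally show "ip N z z = 1" .
  show "z b = of_real (1 / s) * y b" if "b < N" for b
    using that by (simp add: z_def)
  show "z b = 0" if "b \<ge> N" for b
    using that by (simp add: z_def)
qed

text \<open>Here \<open>x\<close> is the \<open>a\<close>-th standard basis vector minus its
  projection to the span of the \<open>u i\<close>. Being orthogonal to that span, it satisfies <x,
  x> = <e, x> = x a, which is the stated squared norm. The formula serves both to find a vector
  outside an incomplete system and to show that a system of \<open>N\<close> vectors is
  complete.\<close>

lemma basis_vector_residual:
  fixes k :: nat
  assumes orth: "\<And>i j. i < k \<Longrightarrow> j < k \<Longrightarrow> ip N (u i) (u j) = (if i = j then 1 else 0)"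
    and a: "a < N"
  defines "x \<equiv> \<lambda>b. (if b = a then 1 else 0) - (\<Sum>i<k. cnj (u i a) * u i b)"
  shows "j < k \<Longrightarrow> ip N (u j) x = 0"
    and "ip N x x = of_real (1 - (\<Sum>i<k. (cmod (u i a))\<^sup>2))"
proof -
  define e where "e = (\<lambda>b. if b = a then 1 else 0 :: complex)"
  have x: "x = (\<lambda>b. e b - (\<Sum>i<k. cnj (u i a) * u i b))"
    by (simp add: x_def e_def)
  have ip_e: "ip N y e = cnj (y a)" "ip N e y = y a" for y
    using a by (simp_all add: ip_def e_def if_distrib if_distribR cong: if_cong)
  have ip_u: "ip N (u j) x = 0" if "j < k" for j
  proof -
    have "ip N (u j) x = cnj (u j a) - (\<Sum>i<k. cnj (u i a) * ip N (u j) (u i))"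
      by (simp add: x ip_diff_right ip_sum_right ip_scale_right ip_e)
    also have "\<dots> = 0"
      using that by (simp add: orth if_distrib cong: if_cong)
    finally show ?thesis .
  qed
  then show "j < k \<Longrightarrow> ip N (u j) x = 0" .
  have "ip N x x = ip N e x - (\<Sum>i<k. u i a * ip N (u i) x)"
    by (subst (1) x) (simp add: ip_diff_left ip_sum_left ip_scale_left)
  also have "\<dots> = x a"
    using ip_u by (simp add: ip_e)
  also have "\<dots> = of_real (1 - (\<Sum>i<k. (cmod (u i a))\<^sup>2))"
    by (simp add: x_def complex_norm_square mult.commute del: of_real_power)
  finally show "ip N x x = of_real (1 - (\<Sum>i<k. (cmod (u i a))\<^sup>2))" .
qed

text \<open>Pigeonhole: the squared entries of the \<open>u i\<close> add up to \<open>k\<close> in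
  total, so among \<open>N > k\<close> coordinates some \<open>a\<close> receives less than 1, and
  the residual of that basis vector is nonzero.\<close>

lemma exists_unit_orthogonal:
  assumes k: "k < N" and orth: "\<And>i j. i < k \<Longrightarrow> j < k \<Longrightarrow> ip N (u i) (u j) = (if i = j then 1 else 0)"
  shows "\<exists>x. (\<forall>i\<ge>N. x i = 0) \<and> ip N x x = 1 \<and> (\<forall>i<k. ip N (u i) x = 0)"
proof -
  have "(\<Sum>a<N. \<Sum>i<k. (cmod (u i a))\<^sup>2) = (\<Sum>i<k. \<Sum>a<N. (cmod (u i a))\<^sup>2)"
    by (rule sum.swap)
  also have "\<dots> = (\<Sum>i<k. 1)"
    using orth by (intro sum.cong unit_vector_norm) auto
  also have "\<dots> < (\<Sum>a<N. 1)"
    using k by simp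
  finally obtain a where a: "a < N" "(\<Sum>i<k. (cmod (u i a))\<^sup>2) < 1"
    by (meson lessThan_iff not_le sum_mono)
  define x where "x = (\<lambda>b. (if b = a then 1 else 0) - (\<Sum>i<k. cnj (u i a) * u i b))"
  have residual: "ip N x x = of_real (1 - (\<Sum>i<k. (cmod (u i a))\<^sup>2))"
    unfolding x_def by (rule basis_vector_residual(2)[OF orth a(1)])
  have "Re (ip N x x) \<noteq> 0"
    using a(2) by (simp add: residual)
  then obtain s z where "s > 0" "ip N x x = of_real (s\<^sup>2)" and z: "ip N z z = 1" "\<And>b. b < N \<Longrightarrow> z b = of_real (1 / s) * x b" "\<And>b. b \<ge> N \<Longrightarrow> z b = 0"
    by (rule normalize_vector) auto
  have "ip N (u i) z = 0" if "i < k" for i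
  proof -
    have "ip N (u i) z = ip N (u i) (\<lambda>b. of_real (1 / s) * x b)"
      by (rule ip_cong) (simp_all add: z)
    moreover have "ip N (u i) x = 0"
      unfolding x_def by (rule basis_vector_residual(1)[OF orth a(1) that])
    ultimately show ?thesis
      by (simp only: ip_scale_right mult_zero_right)
  qed
  with z show ?thesis
    by blast
qed

text \<open>The maximiser \<open>w\<close> of the quadratic form on the unit sphere of the
  orthogonal complement of the \<open>u i\<close> is an eigenvector. Its residual \<open>r\<close>
  lies again in that complement, because \<open>B\<close> is Hermitian and the \<open>u i\<close>
  are eigenvectors, so \<open>w\<close> may be perturbed in the direction of \<open>r\<close>;
  maximality then forces \<open>r = 0\<close>.\<close>

lemma exists_eigenvector_orthogonal:
  assumes herm: "herm N B" and k: "k < N"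
    and orth: "\<And>i j. i < k \<Longrightarrow> j < k \<Longrightarrow> ip N (u i) (u j) = (if i = j then 1 else 0)"
    and eig: "\<And>i a. i < k \<Longrightarrow> a < N \<Longrightarrow> mv N B (u i) a = of_real (l i) * u i a"
  shows "\<exists>w \<mu>. ip N w w = 1 \<and> (\<forall>i<k. ip N (u i) w = 0) \<and>
           (\<forall>a<N. mv N B w a = of_real \<mu> * w a)"
proof -
  define K where "K = {x::cvec. (\<forall>i\<ge>N. x i = 0) \<and> ip N x x = 1 \<and> (\<forall>i<k. ip N (u i) x = 0)}"
  have K: "compact K" "K \<noteq> {}"
    using compact_unit_orthogonal exists_unit_orthogonal[OF k, of u] orth unfolding K_def by blast+
  have "continuous_on K (\<lambda>x. Re (ip N x (mv N B x)))"
  proof (rule continuous_on_subset)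
    have c: "continuous_on UNIV (\<lambda>x::cvec. x i)" for i
      by simp
    show "continuous_on UNIV (\<lambda>x. Re (ip N x (mv N B x)))"
      unfolding ip_def mv_def by (intro c continuous_intros)
  qed simp
  from continuous_attains_sup[OF K this]
  obtain w where w: "w \<in> K" "\<And>y. y \<in> K \<Longrightarrow> Re (ip N y (mv N B y)) \<le> Re (ip N w (mv N B w))"
    by blast
  define \<mu> where "\<mu> = Re (ip N w (mv N B w))"
  \<comment> \<open>The sesquilinear form of \<mu> - B. It is nonnegative on the complement and
    vanishes at \<open>w\<close>, so along \<open>w - e r\<close> only a linear and a quadratic term
    in \<open>e\<close> remain.\<close>
  define h where "h x y = of_real \<mu> * ip N x y - ip N x (mv N B y)" for x y
  have h_nonneg: "0 \<le> Re (h y y)" if y: "\<forall>i<k. ip N (u i) y = 0" for y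
  proof (cases "Re (ip N y y) = 0")
    case True
    then have "\<forall>a<N. y a = 0"
      by (simp add: ip_self_eq_0)
    then show ?thesis
      by (simp add: h_def ip_def)
  next
    case False
    then obtain s z where s: "s > 0" "ip N y y = of_real (s\<^sup>2)" and zz: "ip N z z = 1"
      and z: "\<And>b. b < N \<Longrightarrow> z b = of_real (1 / s) * y b" and z0: "\<And>b. b \<ge> N \<Longrightarrow> z b = 0"
      by (rule normalize_vector) auto
    have "ip N (u i) z = 0" if "i < k" for i
    proof -
      have "ip N (u i) z = ip N (u i) (\<lambda>b. of_real (1/s) * y b)"
        by (rule ip_cong) (simp_all add: z)
      then show ?thesis
        using y that by (simp add: ip_scale_right del: of_real_divide)
    qed
    then have "z \<in> K"
      using zz z0 by (simp add: K_def)
    then have "Re (ip N z (mv N B z)) \<le> \<mu>"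
      using w by (simp add: \<mu>_def)
    also have "mv N B z = mv N B (\<lambda>b. of_real (1 / s) * y b)"
      by (rule mv_cong) (simp add: z)
    also have "ip N z \<dots> = ip N (\<lambda>b. of_real (1 / s) * y b) (mv N B (\<lambda>b. of_real (1 / s) * y b))"
      by (rule ip_cong) (simp_all add: z)
    also have "\<dots> = of_real (1/s) * (of_real (1/s) * ip N y (mv N B y))"
      by (simp only: mv_scale_right ip_scale_left ip_scale_right complex_cnj_complex_of_real)
    finally have "Re (ip N y (mv N B y)) \<le> \<mu> * s\<^sup>2"
      using s(1) by (simp add: field_simps power2_eq_square)
    then show ?thesis
      using s(2) by (simp add: h_def)
  qed
  have ww: "ip N w w = 1" "\<And>i. i < k \<Longrightarrow> ip N (u i) w = 0"
    using w(1) by (auto simp: K_def)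
  define r where "r = (\<lambda>a. of_real \<mu> * w a - mv N B w a)"
  have ru: "ip N (u i) r = 0" if "i < k" for i
  proof -
    have "ip N (u i) (mv N B w) = ip N (mv N B (u i)) w"
      by (rule herm_ip[OF herm])
    also have "\<dots> = ip N (\<lambda>a. of_real (l i) * u i a) w"
      using eig[OF that] by (intro ip_cong) auto
    also have "\<dots> = 0"
      using ww(2)[OF that] by (simp add: ip_scale_left)
    finally show ?thesis
      using ww(2)[OF that] by (simp add: r_def ip_diff_right ip_scale_right)
  qed
  have hw: "Re (h w w) = 0"
    using ww by (simp add: h_def \<mu>_def)
  have hxr: "h x w = ip N x r" for x
    by (simp add: h_def r_def ip_diff_right ip_scale_right)
  have hrx: "h w x = ip N r x" for x
    using herm_ip[OF herm, of w x]
    by (simp add: h_def r_def ip_diff_left ip_scale_left)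
  define \<rho> where "\<rho> = Re (ip N r r)"
  define \<eta> where "\<eta> = Re (h r r)"
  have key: "0 \<le> - 2 * e * \<rho> + e\<^sup>2 * \<eta>" for e
  proof -
    define y where "y = (\<lambda>a. w a - of_real e * r a)"
    have "\<forall>i<k. ip N (u i) y = 0"
      by (simp add: y_def ip_diff_right ip_scale_right ru ww)
    then have "0 \<le> Re (h y y)"
      by (rule h_nonneg)
    also have "h y y = h w w - of_real e * h w r - of_real e * h r w + of_real e * of_real e * h r r"
      by (simp add: h_def y_def mv_diff_right mv_scale_right ip_diff_right ip_diff_left ip_scale_right
          ip_scale_left algebra_simps)
    also have "Re \<dots> = - 2 * e * \<rho> + e\<^sup>2 * \<eta>"
      by (simp add: hw[unfolded hxr] hxr hrx \<rho>_def \<eta>_def power2_eq_square algebra_simps)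
    finally show ?thesis .
  qed
  have "\<rho> = 0"
  proof (rule ccontr)
    assume "\<rho> \<noteq> 0"
    then have \<rho>: "\<rho> > 0"
      using ip_self_nonneg[of N r] by (simp add: \<rho>_def)
    have \<eta>: "\<eta> \<ge> 0"
      unfolding \<eta>_def using ru by (intro h_nonneg) auto
    \<comment> \<open>A step small enough for the linear term to win; the \<open>+ 1\<close> keeps
      the quotient meaningful when \<eta> vanishes.\<close>
    define q where "q = \<rho> / (\<eta> + 1)"
    have q: "q > 0" "\<rho> = q * (\<eta> + 1)"
      using \<rho> \<eta> by (simp_all add: q_def)
    have "0 \<le> - 2 * q * \<rho> + q\<^sup>2 * \<eta>"
      by (rule key)
    also have "\<dots> = - (q\<^sup>2 * (\<eta> + 2))"
      by (simp add: q(2) power2_eq_square algebra_simps)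
    also have "\<dots> < 0"
      using q(1) \<eta> by simp
    finally show False
      by simp
  qed
  then have "\<forall>a<N. r a = 0"
    unfolding \<rho>_def ip_self_eq_0 .
  then have "\<forall>a<N. mv N B w a = of_real \<mu> * w a"
    by (simp add: r_def)
  with ww show ?thesis
    by blast
qed

definition onb :: "nat \<Rightarrow> (nat \<Rightarrow> cvec) \<Rightarrow> bool" where
  "onb N u \<longleftrightarrow> (\<forall>i<N. \<forall>j<N. ip N (u i) (u j) = (if i = j then 1 else 0))"

definition spec :: "nat \<Rightarrow> cmat \<Rightarrow> (nat \<Rightarrow> real) \<Rightarrow> (nat \<Rightarrow> cvec) \<Rightarrow> bool" where
  "spec N B l u \<longleftrightarrow> onb N u \<and> (\<forall>i<N. \<forall>a<N. mv N B (u i) a = of_real (l i) * u i a)"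

theorem spectral_theorem:
  assumes "herm N B"
  shows "\<exists>l u. spec N B l u"
proof -
  have "\<exists>l u. (\<forall>i<k. \<forall>j<k. ip N (u i) (u j) = (if i = j then 1 else 0)) \<and>
               (\<forall>i<k. \<forall>a<N. mv N B (u i) a = of_real (l i) * u i a)" if "k \<le> N" for k
    using that
  proof (induction k)
    case 0
    then show ?case by simp
  next
    case (Suc k)
    then have "k \<le> N"
      by simp
    from Suc.IH[OF this] obtain l u where *: "\<And>i j. i < k \<Longrightarrow> j < k \<Longrightarrow> ip N (u i) (u j) = (if i = j then 1 else 0)"
      "\<And>i a. i < k \<Longrightarrow> a < N \<Longrightarrow> mv N B (u i) a = of_real (l i) * u i a"
      by blast
    obtain w \<mu> where w: "ip N w w = 1" "\<And>i. i < k \<Longrightarrow> ip N (u i) w = 0"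
      "\<And>a. a < N \<Longrightarrow> mv N B w a = of_real \<mu> * w a"
      using exists_eigenvector_orthogonal[OF assms Suc_le_lessD[OF Suc.prems] *] by blast
    have w': "ip N w (u i) = 0" if "i < k" for i
      using w(2)[OF that] ip_cnj[of N "u i" w] by simp
    show ?case
      by (rule exI[of _ "l(k := \<mu>)"], rule exI[of _ "u(k := w)"])
        (auto simp: less_Suc_eq * w w')
  qed
  from this[of N] show ?thesis
    unfolding spec_def onb_def by blast
qed

section \<open>Traces and functions of Hermitian matrices\<close>

lemma onbD: "onb N u \<Longrightarrow> i < N \<Longrightarrow> j < N \<Longrightarrow> ip N (u i) (u j) = (if i = j then 1 else 0)"
  by (simp add: onb_def)

lemma onb_norm: "onb N u \<Longrightarrow> i < N \<Longrightarrow> (\<Sum>a<N. (cmod (u i a))\<^sup>2) = 1"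
  by (simp add: unit_vector_norm onbD)

text \<open>Dimension count: the squared norms of the residuals of the \<open>N\<close> standard
  basis vectors are nonnegative and add up to N - N = 0, so every residual vanishes.\<close>

lemma onb_complete:
  assumes onb: "onb N u" and ab: "a < N" "b < N"
  shows "(\<Sum>i<N. u i b * cnj (u i a)) = (if a = b then 1 else 0)"
proof -
  define x where "x a = (\<lambda>b. (if b = a then 1 else 0) - (\<Sum>i<N. cnj (u i a) * u i b))" for a
  have xx: "Re (ip N (x a) (x a)) = 1 - (\<Sum>i<N. (cmod (u i a))\<^sup>2)" if "a < N" for a
    using basis_vector_residual(2)[where u = u and k = N, OF onbD[OF onb] that, folded x_def] by simp
  have "(\<Sum>a<N. Re (ip N (x a) (x a))) = (\<Sum>a<N. 1) - (\<Sum>a<N. \<Sum>i<N. (cmod (u i a))\<^sup>2)"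
    by (simp add: xx sum_subtractf)
  also have "(\<Sum>a<N. \<Sum>i<N. (cmod (u i a))\<^sup>2) = (\<Sum>i<N. \<Sum>a<N. (cmod (u i a))\<^sup>2)"
    by (rule sum.swap)
  also have "\<dots> = (\<Sum>i<N. 1)"
    using onb_norm[OF onb] by simp
  finally have "(\<Sum>a<N. Re (ip N (x a) (x a))) = 0"
    by simp
  then have "Re (ip N (x a) (x a)) = 0"
    using ab(1) by (subst (asm) sum_nonneg_eq_0_iff) (auto simp: ip_self_nonneg)
  then have "x a b = 0"
    using ab(2) unfolding ip_self_eq_0 by blast
  then show ?thesis
    by (auto simp: x_def mult.commute)
qed

lemma onb_expand:
  assumes "onb N u" "b < N"
  shows "(\<Sum>i<N. ip N (u i) y * u i b) = y b"
proof -
  have "(\<Sum>i<N. ip N (u i) y * u i b) = (\<Sum>i<N. \<Sum>a<N. y a * (u i b * cnj (u i a)))"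
    by (simp add: ip_def sum_distrib_right sum_distrib_left mult_ac)
  also have "\<dots> = (\<Sum>a<N. \<Sum>i<N. y a * (u i b * cnj (u i a)))"
    by (rule sum.swap)
  also have "\<dots> = (\<Sum>a<N. y a * (if a = b then 1 else 0))"
    using assms by (simp add: sum_distrib_left[symmetric] onb_complete)
  also have "\<dots> = y b"
    using assms by (simp add: if_distrib cong: if_cong)
  finally show ?thesis .
qed

lemma parseval:
  assumes "onb N u"
  shows "ip N x y = (\<Sum>i<N. ip N x (u i) * ip N (u i) y)"
proof -
  have "ip N x y = ip N x (\<lambda>b. \<Sum>i<N. ip N (u i) y * u i b)"
    by (rule ip_cong) (simp_all add: onb_expand[OF assms])
  then show ?thesis
    by (simp only: ip_sum_right ip_scale_right mult.commute[of "ip N x _"])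
qed

lemma parseval_norm:
  assumes "onb N u"
  shows "Re (ip N x x) = (\<Sum>i<N. (cmod (ip N (u i) x))\<^sup>2)"
proof -
  have "ip N x x = (\<Sum>i<N. ip N (u i) x * cnj (ip N (u i) x))"
    by (subst parseval[OF assms]) (simp add: ip_cnj mult.commute)
  also have "\<dots> = of_real (\<Sum>i<N. (cmod (ip N (u i) x))\<^sup>2)"
    by (simp add: complex_norm_square del: of_real_power)
  finally show ?thesis
    by simp
qed

text \<open>For orthonormal bases these numbers form a doubly stochastic matrix. Traces that involve
  two eigenbases become averages with these weights, which reduces trace inequalities to scalar
  ones.\<close>

definition overlap :: "nat \<Rightarrow> (nat \<Rightarrow> cvec) \<Rightarrow> (nat \<Rightarrow> cvec) \<Rightarrow> nat \<Rightarrow> nat \<Rightarrow> real" where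
  "overlap N u v i j = (cmod (ip N (u i) (v j)))\<^sup>2"

lemma overlap_nonneg: "0 \<le> overlap N u v i j"
  by (simp add: overlap_def)

lemma overlap_sum_left:
  assumes "onb N u" "onb N v" "j < N"
  shows "(\<Sum>i<N. overlap N u v i j) = 1"
  using parseval_norm[OF assms(1), of "v j"] onbD[OF assms(2,3,3)] by (simp add: overlap_def)

lemma overlap_sum_right:
  assumes "onb N u" "onb N v" "i < N"
  shows "(\<Sum>j<N. overlap N u v i j) = 1"
proof -
  have "overlap N u v i j = overlap N v u j i" for j
    unfolding overlap_def by (metis complex_mod_cnj ip_cnj)
  then show ?thesis
    using overlap_sum_left[OF assms(2,1,3)] by simp
qed

lemma sum_overlap:
  assumes "onb N u" "onb N v"
  shows "(\<Sum>i<N. \<Sum>j<N. overlap N u v i j * f i) = (\<Sum>i<N. f i)"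
    and "(\<Sum>i<N. \<Sum>j<N. overlap N u v i j * g j) = (\<Sum>j<N. g j)"
proof -
  show "(\<Sum>i<N. \<Sum>j<N. overlap N u v i j * f i) = (\<Sum>i<N. f i)"
    using overlap_sum_right[OF assms] by (simp add: sum_distrib_right[symmetric])
  have "(\<Sum>i<N. \<Sum>j<N. overlap N u v i j * g j) = (\<Sum>j<N. \<Sum>i<N. overlap N u v i j * g j)"
    by (rule sum.swap)
  also have "\<dots> = (\<Sum>j<N. g j)"
    using overlap_sum_left[OF assms] by (simp add: sum_distrib_right[symmetric])
  finally show "(\<Sum>i<N. \<Sum>j<N. overlap N u v i j * g j) = (\<Sum>j<N. g j)" .
qed

text \<open>Functional calculus in terms of spectral data instead of a matrix. With the identity for
  \<open>f\<close> it is the general Hermitian matrix with eigenvalues \<open>l\<close> and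
  eigenvectors \<open>u\<close>, the form in which positive matrices enter the entropy
  arguments.\<close>

definition hfun :: "nat \<Rightarrow> (real \<Rightarrow> real) \<Rightarrow> (nat \<Rightarrow> real) \<Rightarrow> (nat \<Rightarrow> cvec) \<Rightarrow> cmat" where
  "hfun N f l u = (\<lambda>a b. \<Sum>i<N. of_real (f (l i)) * (u i a * cnj (u i b)))"

definition qf :: "nat \<Rightarrow> cmat \<Rightarrow> cvec \<Rightarrow> real" where
  "qf N F x = Re (ip N x (mv N F x))"

definition trp :: "nat \<Rightarrow> cmat \<Rightarrow> cmat \<Rightarrow> real" where
  "trp N F G = Re (\<Sum>a<N. \<Sum>b<N. F a b * G b a)"

definition mtr :: "nat \<Rightarrow> cmat \<Rightarrow> real" where
  "mtr N F = Re (\<Sum>a<N. F a a)"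

lemma mv_hfun: "mv N (hfun N f l u) x = (\<lambda>a. \<Sum>i<N. of_real (f (l i)) * ip N (u i) x * u i a)"
proof
  fix a
  have "mv N (hfun N f l u) x a = (\<Sum>b<N. \<Sum>i<N. of_real (f (l i)) * (u i a * cnj (u i b)) * x b)"
    by (simp add: mv_def hfun_def sum_distrib_right)
  also have "\<dots> = (\<Sum>i<N. \<Sum>b<N. of_real (f (l i)) * (u i a * cnj (u i b)) * x b)"
    by (rule sum.swap)
  also have "\<dots> = (\<Sum>i<N. of_real (f (l i)) * ip N (u i) x * u i a)"
    by (simp add: ip_def sum_distrib_left sum_distrib_right mult_ac)
  finally show "mv N (hfun N f l u) x a = (\<Sum>i<N. of_real (f (l i)) * ip N (u i) x * u i a)" .
qed

lemma ip_mv_hfun: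
  "ip N x (mv N (hfun N f l u) y) = (\<Sum>i<N. of_real (f (l i)) * (ip N (u i) y * ip N x (u i)))"
  by (simp add: mv_hfun ip_sum_right ip_scale_right mult.assoc)

lemma qf_hfun: "qf N (hfun N f l u) x = (\<Sum>i<N. f (l i) * (cmod (ip N (u i) x))\<^sup>2)"
proof -
  have "ip N (u i) x * ip N x (u i) = of_real ((cmod (ip N (u i) x))\<^sup>2)" for i
    by (metis complex_norm_square ip_cnj)
  then have "ip N x (mv N (hfun N f l u) x) = of_real (\<Sum>i<N. f (l i) * (cmod (ip N (u i) x))\<^sup>2)"
    by (simp add: ip_mv_hfun)
  then show ?thesis
    by (simp add: qf_def)
qed

lemma mtr_hfun:
  assumes "onb N u"
  shows "mtr N (hfun N f l u) = (\<Sum>i<N. f (l i))"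
proof -
  have "(\<Sum>a<N. hfun N f l u a a) = (\<Sum>i<N. \<Sum>a<N. of_real (f (l i)) * (u i a * cnj (u i a)))"
    unfolding hfun_def by (rule sum.swap)
  also have "\<dots> = (\<Sum>i<N. of_real (f (l i)) * of_real (\<Sum>a<N. (cmod (u i a))\<^sup>2))"
    by (simp add: sum_distrib_left complex_norm_square del: of_real_power)
  also have "\<dots> = of_real (\<Sum>i<N. f (l i))"
    using onb_norm[OF assms] by simp
  finally show ?thesis
    by (simp add: mtr_def)
qed

lemma trp_hfun_right: "trp N F (hfun N g k v) = (\<Sum>j<N. g (k j) * qf N F (v j))"
proof -
  have "(\<Sum>a<N. \<Sum>b<N. F a b * hfun N g k v b a)
      = (\<Sum>a<N. \<Sum>b<N. \<Sum>j<N. of_real (g (k j)) * (cnj (v j a) * (F a b * v j b)))"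
    by (simp add: hfun_def sum_distrib_left mult_ac)
  also have "\<dots> = (\<Sum>a<N. \<Sum>j<N. \<Sum>b<N. of_real (g (k j)) * (cnj (v j a) * (F a b * v j b)))"
    by (intro sum.cong refl sum.swap)
  also have "\<dots> = (\<Sum>j<N. \<Sum>a<N. \<Sum>b<N. of_real (g (k j)) * (cnj (v j a) * (F a b * v j b)))"
    by (rule sum.swap)
  also have "\<dots> = (\<Sum>j<N. of_real (g (k j)) * ip N (v j) (mv N F (v j)))"
    by (simp add: ip_def mv_def sum_distrib_left)
  finally show ?thesis
    by (simp add: trp_def qf_def)
qed

lemma trp_hfun:
  "trp N (hfun N f l u) (hfun N g k v) = (\<Sum>i<N. \<Sum>j<N. overlap N u v i j * (f (l i) * g (k j)))"
proof -
  have "trp N (hfun N f l u) (hfun N g k v)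
      = (\<Sum>j<N. \<Sum>i<N. overlap N u v i j * (f (l i) * g (k j)))"
    by (simp add: trp_hfun_right qf_hfun overlap_def sum_distrib_left mult_ac)
  then show ?thesis
    by (subst sum.swap)
qed

lemma trp_hfun_same:
  assumes "onb N u"
  shows "trp N (hfun N f l u) (hfun N g l u) = (\<Sum>i<N. f (l i) * g (l i))"
proof -
  have "qf N (hfun N f l u) (u j) = f (l j)" if "j < N" for j
  proof -
    have "qf N (hfun N f l u) (u j) = (\<Sum>i<N. if i = j then f (l i) else 0)"
      unfolding qf_hfun using that onbD[OF assms] by (intro sum.cong) auto
    then show ?thesis
      using that by simp
  qed
  then show ?thesis
    by (simp add: trp_hfun_right mult.commute)
qed

lemma trp_add_right: "trp N F (\<lambda>a b. A a b + B a b) = trp N F A + trp N F B"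
  by (simp add: trp_def distrib_left sum.distrib)

lemma trp_cong:
  "(\<And>a b. a < N \<Longrightarrow> b < N \<Longrightarrow> F a b = F' a b) \<Longrightarrow> (\<And>a b. a < N \<Longrightarrow> b < N \<Longrightarrow> G a b = G' a b)
    \<Longrightarrow> trp N F G = trp N F' G'"
  by (simp add: trp_def)

lemma mtr_cong: "(\<And>a. a < N \<Longrightarrow> F a a = F' a a) \<Longrightarrow> mtr N F = mtr N F'"
  by (simp add: mtr_def)

lemma qf_cong:
  "(\<And>a b. a < N \<Longrightarrow> b < N \<Longrightarrow> F a b = F' a b) \<Longrightarrow> qf N F x = qf N F' x"
  by (simp add: qf_def ip_def mv_def)

lemma spec_hfun:
  assumes "spec N B l u" "a < N" "b < N"
  shows "B a b = hfun N (\<lambda>x. x) l u a b"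
proof -
  have u: "onb N u"
    using assms by (simp add: spec_def)
  have "B a b = (\<Sum>c<N. B a c * (if b = c then 1 else 0))"
    using assms by (simp add: if_distrib cong: if_cong)
  also have "\<dots> = (\<Sum>c<N. B a c * (\<Sum>i<N. u i c * cnj (u i b)))"
    using assms by (intro sum.cong refl) (simp add: onb_complete[OF u])
  also have "\<dots> = (\<Sum>c<N. \<Sum>i<N. B a c * u i c * cnj (u i b))"
    by (simp add: sum_distrib_left mult_ac)
  also have "\<dots> = (\<Sum>i<N. \<Sum>c<N. B a c * u i c * cnj (u i b))"
    by (rule sum.swap)
  also have "\<dots> = (\<Sum>i<N. mv N B (u i) a * cnj (u i b))"
    by (simp add: mv_def sum_distrib_right)
  also have "\<dots> = hfun N (\<lambda>x. x) l u a b"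
    using assms by (simp add: spec_def hfun_def mult_ac)
  finally show ?thesis .
qed

section \<open>Matrix powers and a fixed choice of spectral data\<close>

definition mmul :: "nat \<Rightarrow> cmat \<Rightarrow> cmat \<Rightarrow> cmat" where
  "mmul N A B = (\<lambda>a b. \<Sum>c<N. A a c * B c b)"

fun mpow :: "nat \<Rightarrow> cmat \<Rightarrow> nat \<Rightarrow> cmat" where
  "mpow N A 0 = (\<lambda>a b. if a = b then 1 else 0)"
| "mpow N A (Suc k) = mmul N A (mpow N A k)"

lemma spec_mpow:
  assumes "spec N B l u"
  shows "a < N \<Longrightarrow> b < N \<Longrightarrow> mpow N B k a b = hfun N (\<lambda>x. x ^ k) l u a b"
proof (induction k arbitrary: a)
  case 0
  then show ?case
    using onb_complete[of N u b a] assms by (auto simp: hfun_def spec_def)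
next
  case (Suc k)
  have "mpow N B (Suc k) a b = (\<Sum>c<N. \<Sum>i<N. of_real (l i ^ k) * (B a c * u i c * cnj (u i b)))"
    using Suc by (simp add: mmul_def hfun_def sum_distrib_left mult_ac)
  also have "\<dots> = (\<Sum>i<N. \<Sum>c<N. of_real (l i ^ k) * (B a c * u i c * cnj (u i b)))"
    by (rule sum.swap)
  also have "\<dots> = (\<Sum>i<N. of_real (l i ^ k) * (mv N B (u i) a * cnj (u i b)))"
    by (simp add: mv_def sum_distrib_right sum_distrib_left mult_ac)
  also have "\<dots> = hfun N (\<lambda>x. x ^ Suc k) l u a b"
    using assms Suc.prems by (simp add: spec_def hfun_def mult_ac)
  finally show ?case .
qed

text \<open>Junk unless \<open>B\<close> is Hermitian; the eigenvalues are unsorted and repeated with multiplicity.\<close>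

definition eigs :: "nat \<Rightarrow> cmat \<Rightarrow> nat \<Rightarrow> real" where
  "eigs N B = (SOME l. \<exists>u. spec N B l u)"

text \<open>Chosen after the eigenvalues are fixed, so that both choices belong to one
  eigenbasis.\<close>

definition evecs :: "nat \<Rightarrow> cmat \<Rightarrow> nat \<Rightarrow> cvec" where
  "evecs N B = (SOME u. spec N B (eigs N B) u)"

lemma spec_eigs: "herm N B \<Longrightarrow> spec N B (eigs N B) (evecs N B)"
  unfolding evecs_def eigs_def using someI_ex[OF spectral_theorem] by (rule someI_ex)

lemma onb_evecs: "herm N B \<Longrightarrow> onb N (evecs N B)"
  using spec_eigs by (auto simp: spec_def)

lemma mv_evecs: "herm N F \<Longrightarrow> i < N \<Longrightarrow> a < N \<Longrightarrow> mv N F (evecs N F i) a = of_real (eigs N F i) * evecs N F i a"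
  using spec_eigs by (auto simp: spec_def)

lemma herm_hfun_eigs: "herm N B \<Longrightarrow> a < N \<Longrightarrow> b < N \<Longrightarrow> B a b = hfun N (\<lambda>x. x) (eigs N B) (evecs N B) a b"
  using spec_hfun[OF spec_eigs] .

lemma spec_cong:
  assumes "\<And>a b. a < N \<Longrightarrow> b < N \<Longrightarrow> B a b = B' a b"
  shows "spec N B = spec N B'"
  using assms by (simp add: spec_def mv_def fun_eq_iff)

text \<open>Both choices are made from the predicate \<open>spec N B\<close> alone, so equality of
  these predicates suffices, and junk entries cannot influence the result.\<close>

lemma eigs_cong:
  assumes "\<And>a b. a < N \<Longrightarrow> b < N \<Longrightarrow> B a b = B' a b"
  shows "eigs N B = eigs N B'" "evecs N B = evecs N B'"
proof -
  have "spec N B = spec N B'"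
    using assms by (rule spec_cong)
  then show "eigs N B = eigs N B'" "evecs N B = evecs N B'"
    by (simp_all add: evecs_def eigs_def)
qed

section \<open>The matrix exponential and its trace\<close>

definition mexp :: "nat \<Rightarrow> cmat \<Rightarrow> cmat" where
  "mexp N B = hfun N exp (eigs N B) (evecs N B)"

definition tr_exp :: "nat \<Rightarrow> cmat \<Rightarrow> real" where
  "tr_exp N B = mtr N (mexp N B)"

lemma mexp_cong: "(\<And>a b. a < N \<Longrightarrow> b < N \<Longrightarrow> B a b = B' a b) \<Longrightarrow> mexp N B = mexp N B'"
  using eigs_cong[of N B B'] by (simp add: mexp_def)

lemma tr_exp_eigs: "herm N B \<Longrightarrow> tr_exp N B = (\<Sum>i<N. exp (eigs N B i))"
  by (simp add: tr_exp_def mexp_def mtr_hfun onb_evecs)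

text \<open>Arbitrarily chosen eigenbases carry no measurability in \<open>B\<close>. The power
  series does: its partial sums are polynomials in the entries.\<close>

lemma mpow_sums_mexp:
  assumes "herm N B" "a < N" "b < N"
  shows "(\<lambda>k. mpow N B k a b / fact k) sums mexp N B a b"
proof -
  let ?l = "eigs N B" and ?u = "evecs N B"
  have "(\<lambda>k. \<Sum>i<N. of_real (?l i ^ k /\<^sub>R fact k) * (?u i a * cnj (?u i b)))
    sums (\<Sum>i<N. of_real (exp (?l i)) * (?u i a * cnj (?u i b)))"
    by (intro sums_sum sums_mult2 sums_of_real exp_converges)
  then show ?thesis
    using assms by (simp add: spec_mpow[OF spec_eigs] hfun_def mexp_def sum_divide_distrib field_simps)
qed

text \<open>Unit eigenvectors have entries of modulus at most 1. Integrability of the trace thereby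
  yields integrability of every entry of the exponential.\<close>

lemma norm_mexp_le:
  assumes "herm N B" "a < N" "b < N"
  shows "cmod (mexp N B a b) \<le> tr_exp N B"
proof -
  have le1: "cmod (evecs N B i c) \<le> 1" if "i < N" "c < N" for i c
  proof -
    have "(cmod (evecs N B i c))\<^sup>2 \<le> (\<Sum>a<N. (cmod (evecs N B i a))\<^sup>2)"
      using that by (intro member_le_sum) auto
    then show ?thesis
      using onb_norm[OF onb_evecs[OF assms(1)] that(1)] by (simp add: abs_square_le_1)
  qed
  have "cmod (mexp N B a b) \<le> (\<Sum>i<N. cmod (of_real (exp (eigs N B i)) * (evecs N B i a * cnj (evecs N B i b))))"
    unfolding mexp_def hfun_def by (rule norm_sum)
  also have "\<dots> \<le> (\<Sum>i<N. exp (eigs N B i))"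
    using assms le1 by (intro sum_mono) (auto simp: norm_mult intro!: mult_le_one)
  finally show ?thesis
    using assms by (simp add: tr_exp_eigs)
qed

lemma qf_mexp: "qf N (mexp N B) x = (\<Sum>i<N. exp (eigs N B i) * (cmod (ip N (evecs N B i) x))\<^sup>2)"
  by (simp add: mexp_def qf_hfun)

lemma qf_mexp_pos:
  assumes "herm N B" "Re (ip N x x) > 0"
  shows "qf N (mexp N B) x > 0"
proof (rule ccontr)
  assume "\<not> ?thesis"
  moreover have "qf N (mexp N B) x \<ge> 0"
    by (simp add: qf_mexp sum_nonneg)
  ultimately have "qf N (mexp N B) x = 0"
    by simp
  then have "\<forall>i<N. (cmod (ip N (evecs N B i) x))\<^sup>2 = 0"
    by (simp add: qf_mexp sum_nonneg_eq_0_iff)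
  then show False
    using assms(2) parseval_norm[OF onb_evecs[OF assms(1)], of x] by simp
qed

text \<open>Quadratic forms are what the moment hypotheses control; this carries their integrability
  over to the trace exponential.\<close>

lemma mtr_qf: "mtr N F = (\<Sum>a<N. qf N F (\<lambda>b. if b = a then 1 else 0))"
  by (simp add: mtr_def qf_def ip_def mv_def if_distrib if_distribR cong: if_cong)

text \<open>Expanding in both eigenbases leaves an average over the overlaps of 1 + x \<le> exp x at
  \<open>x = c + ?k j - ln (t i)\<close>, multiplied by \<open>t i\<close>. The number
  \<open>c\<close> stands for adding \<open>c\<close> times the identity to
  \<open>K\<close>.\<close>

lemma gibbs_variational:
  assumes u: "onb N u" and t: "\<And>i. i < N \<Longrightarrow> t i > 0" and K: "herm N K"
  shows "trp N (hfun N (\<lambda>x. x) t u) K + c * (\<Sum>i<N. t i) - (\<Sum>i<N. t i * ln (t i)) + (\<Sum>i<N. t i)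
           \<le> exp c * tr_exp N K"
proof -
  let ?k = "eigs N K" and ?v = "evecs N K"
  note v = onb_evecs[OF K]
  have trK: "trp N (hfun N (\<lambda>x. x) t u) K
     = (\<Sum>i<N. \<Sum>j<N. overlap N u ?v i j * (t i * ?k j))"
    using trp_hfun[of N "\<lambda>x. x" t u "\<lambda>x. x" ?k ?v]
    by (subst trp_cong[OF refl herm_hfun_eigs[OF K]]) simp_all
  have scalar: "t i * ?k j + c * t i - t i * ln (t i) + t i \<le> exp (c + ?k j)" if "i < N" for i j
  proof -
    have "1 + (c + ?k j - ln (t i)) \<le> exp (c + ?k j - ln (t i))"
      by (rule exp_ge_add_one_self)
    also have "\<dots> = exp (c + ?k j) / t i"
      using t[OF that] by (simp add: exp_diff)
    finally show ?thesis
      using t[OF that] by (simp add: field_simps)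
  qed
  have "(\<Sum>i<N. \<Sum>j<N. overlap N u ?v i j * (t i * ?k j + c * t i - t i * ln (t i) + t i))
      \<le> (\<Sum>i<N. \<Sum>j<N. overlap N u ?v i j * exp (c + ?k j))"
    using scalar by (intro sum_mono mult_left_mono overlap_nonneg) auto
  also have "\<dots> = exp c * tr_exp N K"
    by (simp add: sum_overlap[OF u v] tr_exp_eigs[OF K] exp_add sum_distrib_left)
  finally show ?thesis
    by (simp add: distrib_left right_diff_distrib sum.distrib sum_subtractf sum_overlap[OF u v] trK
        sum_distrib_left)
qed

lemma eigs_eq_qf:
  assumes "herm N B" "i < N"
  shows "eigs N B i = qf N B (evecs N B i)"
proof -
  have "qf N B (evecs N B i) = Re (ip N (evecs N B i) (\<lambda>a. of_real (eigs N B i) * evecs N B i a))"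
    unfolding qf_def using spec_eigs[OF assms(1)] assms(2)
    by (intro arg_cong[where f = Re] ip_cong) (auto simp: spec_def)
  then show ?thesis
    using onbD[OF onb_evecs[OF assms(1)] assms(2,2)] by (simp add: ip_scale_right)
qed

lemma mexp_hfun_id: "mexp N B = hfun N (\<lambda>x. x) (\<lambda>i. exp (eigs N B i)) (evecs N B)"
  by (simp add: mexp_def hfun_def)

lemma trp_mexp_self: "herm N B \<Longrightarrow> trp N (mexp N B) B = (\<Sum>i<N. exp (eigs N B i) * eigs N B i)"
  using trp_hfun_same[OF onb_evecs, of N B exp "eigs N B" "\<lambda>x. x"] herm_hfun_eigs[of N B]
  by (simp add: mexp_def cong: trp_cong)

text \<open>For orthonormal \<open>u\<close> and \<open>v\<close> and positive \<open>t\<close> and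
  \<open>y\<close> this is the unnormalised quantum relative entropy tr (F ln F - F ln Y - F + Y),
  with F and Y given by their spectral data (t, u) and (y, v).\<close>

definition rel_entropy ::
    "nat \<Rightarrow> (nat \<Rightarrow> real) \<Rightarrow> (nat \<Rightarrow> cvec) \<Rightarrow> (nat \<Rightarrow> real) \<Rightarrow> (nat \<Rightarrow> cvec) \<Rightarrow> real" where
  "rel_entropy N t u y v =
     (\<Sum>i<N. \<Sum>j<N. overlap N u v i j * (t i * ln (t i) - t i * ln (y j) - t i + y j))"

lemma rel_entropy_mexp:
  assumes u: "onb N u" and K: "herm N K"
  shows "rel_entropy N t u (\<lambda>j. exp (eigs N K j)) (evecs N K) =
    (\<Sum>i<N. t i * ln (t i)) - trp N (hfun N (\<lambda>x. x) t u) K - (\<Sum>i<N. t i) + tr_exp N K"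
proof -
  let ?k = "eigs N K" and ?v = "evecs N K"
  note v = onb_evecs[OF K]
  have trK: "trp N (hfun N (\<lambda>x. x) t u) K
     = (\<Sum>i<N. \<Sum>j<N. overlap N u ?v i j * (t i * ?k j))"
    using trp_hfun[of N "\<lambda>x. x" t u "\<lambda>x. x" ?k ?v]
    by (subst trp_cong[OF refl herm_hfun_eigs[OF K]]) simp_all
  show ?thesis
    by (simp add: rel_entropy_def distrib_left right_diff_distrib sum.distrib sum_subtractf
        sum_overlap[OF u v] trK tr_exp_eigs[OF K])
qed

section \<open>Joint convexity of the relative entropy\<close>

definition adj :: "cmat \<Rightarrow> cmat" where
  "adj Z = (\<lambda>a b. cnj (Z b a))"

lemma ip_adj: "ip N x (mv N (adj Z) y) = ip N (mv N Z x) y"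
proof -
  have "ip N x (mv N (adj Z) y) = (\<Sum>a<N. \<Sum>b<N. cnj (Z b a * x a) * y b)"
    by (simp add: ip_def mv_def adj_def sum_distrib_left mult_ac)
  also have "\<dots> = (\<Sum>b<N. \<Sum>a<N. cnj (Z b a * x a) * y b)"
    by (rule sum.swap)
  also have "\<dots> = ip N (mv N Z x) y"
    by (simp add: ip_def mv_def sum_distrib_right)
  finally show ?thesis .
qed

lemma mv_mmul: "mv N (mmul N A B) x = mv N A (mv N B x)"
proof
  fix a
  have "mv N (mmul N A B) x a = (\<Sum>b<N. \<Sum>c<N. A a c * B c b * x b)"
    by (simp add: mv_def mmul_def sum_distrib_right)
  also have "\<dots> = (\<Sum>c<N. \<Sum>b<N. A a c * B c b * x b)"
    by (rule sum.swap)
  also have "\<dots> = mv N A (mv N B x) a"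
    by (simp add: mv_def sum_distrib_left mult_ac)
  finally show "mv N (mmul N A B) x a = mv N A (mv N B x) a" .
qed

lemma Re_ip_commute: "Re (ip N x y) = Re (ip N y x)"
  unfolding ip_cnj[of N x y, symmetric] by simp

lemma adj_adj: "adj (adj Z) = Z"
  by (simp add: adj_def)

text \<open>Together with \<open>coefY\<close> this encodes, for fixed Z and with <Z, W> = tr (Z*
  W), the function 2 Re <Z, F - Y> - r <Z, F Z> - (1 - r) <Z, Z Y>, which is linear in (F, Y).
  \<open>coefT\<close> is its coefficient at F, and \<open>coefY\<close> the one at Y.\<close>

definition coefT :: "nat \<Rightarrow> real \<Rightarrow> cmat \<Rightarrow> cmat" where
  "coefT N r Z = (\<lambda>a b. 2 * adj Z a b - of_real r * mmul N Z (adj Z) a b)"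

definition coefY :: "nat \<Rightarrow> real \<Rightarrow> cmat \<Rightarrow> cmat" where
  "coefY N r Z = (\<lambda>a b. - 2 * adj Z a b - of_real (1 - r) * mmul N (adj Z) Z a b)"

lemma mv_lincomb: "mv N (\<lambda>a b. c * F a b - d * G a b) x = (\<lambda>a. c * mv N F x a - d * mv N G x a)"
  by (simp add: mv_def algebra_simps sum_subtractf sum_distrib_left)

lemma qf_coefT:
  "qf N (coefT N r Z) x = 2 * Re (ip N x (mv N (adj Z) x)) - r * Re (ip N (mv N (adj Z) x) (mv N (adj Z) x))"
  using ip_adj[of N x "adj Z" "mv N (adj Z) x"]
  by (simp add: qf_def coefT_def mv_lincomb mv_mmul ip_diff_right ip_scale_right adj_adj)

lemma qf_coefY:
  "qf N (coefY N r Z) x = - 2 * Re (ip N x (mv N Z x)) - (1 - r) * Re (ip N (mv N Z x) (mv N Z x))"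
proof -
  have "Re (ip N (mv N Z x) x) = Re (ip N x (mv N Z x))"
    by (rule Re_ip_commute)
  then show ?thesis
    unfolding qf_def coefY_def mv_lincomb mv_mmul ip_diff_right ip_scale_right ip_adj
    by simp
qed

text \<open>In the mixed entries <u i, Z v j> left multiplication by the first matrix and right
  multiplication by the second are simultaneously diagonal, with eigenvalues \<open>t i\<close> and
  \<open>y j\<close>. The expression thus splits into independent scalar quadratics, one for each
  pair (i, j).\<close>

lemma coef_expand:
  fixes Z :: cmat
  assumes u: "onb N u" and v: "onb N v"
  defines "z \<equiv> \<lambda>i j. ip N (u i) (mv N Z (v j))"
  shows "trp N (coefT N r Z) (hfun N (\<lambda>x. x) t u) + trp N (coefY N r Z) (hfun N (\<lambda>x. x) y v)
    = (\<Sum>i<N. \<Sum>j<N. 2 * (t i - y j) * Re (ip N (u i) (v j) * cnj (z i j))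
        - (r * t i + (1 - r) * y j) * (cmod (z i j))\<^sup>2)"
proof -
  have zf: "ip N (u i) (mv N Z (v j)) = z i j" for i j
    by (simp add: z_def)
  have z1: "ip N (v j) (mv N (adj Z) (u i)) = cnj (z i j)" for i j
    by (simp add: ip_adj z_def ip_cnj)
  have T1: "Re (ip N (u i) (mv N (adj Z) (u i))) = (\<Sum>j<N. Re (ip N (u i) (v j) * cnj (z i j)))" for i
    by (subst parseval[OF v]) (simp add: z1)
  have T2: "Re (ip N (mv N (adj Z) (u i)) (mv N (adj Z) (u i))) = (\<Sum>j<N. (cmod (z i j))\<^sup>2)" for i
    by (subst parseval_norm[OF v]) (simp add: z1)
  have Y1: "Re (ip N (v j) (mv N Z (v j))) = (\<Sum>i<N. Re (ip N (u i) (v j) * cnj (z i j)))" for j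
  proof -
    have "Re (ip N (v j) (u i) * z i j) = Re (ip N (u i) (v j) * cnj (z i j))" for i
      unfolding ip_cnj[of N "u i" "v j", symmetric] by (simp add: algebra_simps)
    then show ?thesis
      by (subst parseval[OF u]) (simp only: Re_sum zf)
  qed
  have Y2: "Re (ip N (mv N Z (v j)) (mv N Z (v j))) = (\<Sum>i<N. (cmod (z i j))\<^sup>2)" for j
    by (subst parseval_norm[OF u]) (simp add: z_def)
  have "trp N (coefT N r Z) (hfun N (\<lambda>x. x) t u) = (\<Sum>i<N. \<Sum>j<N.
      t i * (2 * Re (ip N (u i) (v j) * cnj (z i j)) - r * (cmod (z i j))\<^sup>2))"
    by (simp only: trp_hfun_right qf_coefT T1 T2 sum_distrib_left sum_subtractf right_diff_distrib)
  moreover have "trp N (coefY N r Z) (hfun N (\<lambda>x. x) y v) = (\<Sum>j<N. \<Sum>i<N.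
      y j * (- 2 * Re (ip N (u i) (v j) * cnj (z i j)) - (1 - r) * (cmod (z i j))\<^sup>2))"
    by (simp only: trp_hfun_right qf_coefY Y1 Y2 sum_distrib_left sum_subtractf right_diff_distrib)
  moreover have "\<dots> = (\<Sum>i<N. \<Sum>j<N.
      y j * (- 2 * Re (ip N (u i) (v j) * cnj (z i j)) - (1 - r) * (cmod (z i j))\<^sup>2))"
    by (rule sum.swap)
  ultimately show ?thesis
    by (simp only: sum.distrib[symmetric]) (intro sum.cong refl, simp add: algebra_simps)
qed

text \<open>The difference of the two sides is q |z - (d / q) c|^2, whence also the case of
  equality.\<close>

lemma complete_square:
  fixes c z :: complex and d q :: real
  assumes "q > 0"
  shows "2 * d * Re (c * cnj z) - q * (cmod z)\<^sup>2 \<le> d\<^sup>2 / q * (cmod c)\<^sup>2"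
    and "z = of_real (d / q) * c \<Longrightarrow> 2 * d * Re (c * cnj z) - q * (cmod z)\<^sup>2 = d\<^sup>2 / q * (cmod c)\<^sup>2"
proof -
  define s where "s = d / q"
  have "q * (cmod (z - of_real s * c))\<^sup>2
      = (s * q) * s * (cmod c)\<^sup>2 - (2 * (s * q) * Re (c * cnj z) - q * (cmod z)\<^sup>2)"
    unfolding cmod_power2 by (simp add: power2_eq_square algebra_simps)
  moreover have "s * q = d"
    using assms by (simp add: s_def)
  ultimately have "d\<^sup>2 / q * (cmod c)\<^sup>2 - (2 * d * Re (c * cnj z) - q * (cmod z)\<^sup>2)
      = q * (cmod (z - of_real (d / q) * c))\<^sup>2"
    unfolding s_def by (simp add: power2_eq_square)
  moreover have "0 \<le> q * (cmod (z - of_real (d / q) * c))\<^sup>2"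
    using assms by simp
  ultimately show "2 * d * Re (c * cnj z) - q * (cmod z)\<^sup>2 \<le> d\<^sup>2 / q * (cmod c)\<^sup>2"
    "z = of_real (d / q) * c \<Longrightarrow> 2 * d * Re (c * cnj z) - q * (cmod z)\<^sup>2 = d\<^sup>2 / q * (cmod c)\<^sup>2"
    by auto
qed

lemma segment_pos:
  fixes t y r :: real
  assumes "t > 0" "y > 0" "r \<in> {0..1}"
  shows "r * t + (1 - r) * y > 0"
proof (cases "r = 0")
  case False
  then show ?thesis
    using assms by (auto intro!: add_pos_nonneg)
qed (use assms in simp)

text \<open>With q = r t + (1 - r) y one has t - q = (1 - r) (t - y) and q' = t - y, so the
  integrand is (t / q - 1) q', the derivative of t ln q - q.\<close>

lemma rel_entropy_integral_scalar:
  fixes t y :: real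
  assumes "t > 0" "y > 0"
  shows "((\<lambda>r. (1 - r) * ((t - y)\<^sup>2 / (r * t + (1 - r) * y))) has_integral
           (t * ln t - t * ln y - t + y)) {0..1}"
proof -
  define q where "q r = r * t + (1 - r) * y" for r
  have q: "q r > 0" if "r \<in> {0..1}" for r
    unfolding q_def by (rule segment_pos[OF assms that])
  have "((\<lambda>r. (t / q r - 1) * (t - y)) has_integral (t * ln (q 1) - q 1) - (t * ln (q 0) - q 0)) {0..1}"
  proof (rule fundamental_theorem_of_calculus)
    fix r :: real assume r: "r \<in> {0..1}"
    have "(q has_real_derivative t - y) (at r within {0..1})"
      unfolding q_def by (auto intro!: derivative_eq_intros)
    then have "((\<lambda>r. t * ln (q r) - q r) has_real_derivative (t / q r - 1) * (t - y)) (at r within {0..1})"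
      using q[OF r] by (auto intro!: derivative_eq_intros simp: field_simps)
    then show "((\<lambda>r. t * ln (q r) - q r) has_vector_derivative (t / q r - 1) * (t - y)) (at r within {0..1})"
      by (simp add: has_real_derivative_iff_has_vector_derivative)
  qed simp
  also have "(t * ln (q 1) - q 1) - (t * ln (q 0) - q 0) = t * ln t - t * ln y - t + y"
    by (simp add: q_def)
  finally show ?thesis
  proof (rule has_integral_eq[rotated])
    fix r :: real assume r: "r \<in> {0..1}"
    have "t / q r - 1 = (t - q r) / q r"
      using q[OF r] by (simp add: field_simps)
    also have "t - q r = (1 - r) * (t - y)"
      by (simp add: q_def algebra_simps)
    finally show "(t / q r - 1) * (t - y) = (1 - r) * ((t - y)\<^sup>2 / (r * t + (1 - r) * y))"
      by (simp add: q_def power2_eq_square)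
  qed
qed

text \<open>The matrix with prescribed mixed entries \<open>z i j\<close> with respect to two
  orthonormal bases; it turns the scalar maximisers into one matrix.\<close>

definition zmat :: "nat \<Rightarrow> (nat \<Rightarrow> cvec) \<Rightarrow> (nat \<Rightarrow> cvec) \<Rightarrow> (nat \<Rightarrow> nat \<Rightarrow> complex) \<Rightarrow> cmat" where
  "zmat N u v z = (\<lambda>a b. \<Sum>i<N. \<Sum>j<N. z i j * (u i a * cnj (v j b)))"

lemma ip_mv_zmat:
  assumes u: "onb N u" and v: "onb N v" and ij: "i < N" "j < N"
  shows "ip N (u i) (mv N (zmat N u v z) (v j)) = z i j"
proof -
  have mv: "mv N (zmat N u v z) (v j) a = (\<Sum>i<N. z i j * u i a)" for a
  proof -
    have "mv N (zmat N u v z) (v j) a = (\<Sum>b<N. \<Sum>i<N. \<Sum>k<N. z i k * u i a * (cnj (v k b) * v j b))"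
      by (simp add: mv_def zmat_def sum_distrib_left sum_distrib_right mult_ac)
    also have "\<dots> = (\<Sum>i<N. \<Sum>b<N. \<Sum>k<N. z i k * u i a * (cnj (v k b) * v j b))"
      by (rule sum.swap)
    also have "\<dots> = (\<Sum>i<N. \<Sum>k<N. \<Sum>b<N. z i k * u i a * (cnj (v k b) * v j b))"
      by (intro sum.cong refl sum.swap)
    also have "\<dots> = (\<Sum>i<N. \<Sum>k<N. z i k * u i a * ip N (v k) (v j))"
      by (simp add: ip_def sum_distrib_left)
    also have "\<dots> = (\<Sum>i<N. \<Sum>k<N. if k = j then z i j * u i a else 0)"
      using ij by (intro sum.cong refl) (simp add: onbD[OF v])
    also have "\<dots> = (\<Sum>i<N. z i j * u i a)"
      using ij by simp
    finally show ?thesis .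
  qed
  have "ip N (u i) (mv N (zmat N u v z) (v j)) = ip N (u i) (\<lambda>a. \<Sum>i<N. z i j * u i a)"
    by (rule ip_cong) (simp_all add: mv)
  also have "\<dots> = (\<Sum>k<N. z k j * ip N (u i) (u k))"
    by (simp add: ip_sum_right ip_scale_right)
  also have "\<dots> = (\<Sum>k<N. if k = i then z i j else 0)"
    using ij by (intro sum.cong refl) (simp add: onbD[OF u])
  finally show ?thesis
    using ij by simp
qed

lemma has_integral_trp:
  assumes "\<And>a b. a < N \<Longrightarrow> b < N \<Longrightarrow> ((\<lambda>r. of_real (g r) * F r a b) has_integral Fint a b) {0..1::real}"
  shows "((\<lambda>r. g r * trp N (F r) G) has_integral trp N Fint G) {0..1}"
proof -
  have "((\<lambda>r. \<Sum>a<N. \<Sum>b<N. of_real (g r) * F r a b * G b a) has_integral (\<Sum>a<N. \<Sum>b<N. Fint a b * G b a)) {0..1}"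
    using assms by (intro has_integral_sum has_integral_mult_left) auto
  from has_integral_linear[OF this bounded_linear_Re]
  have "((\<lambda>r. Re (\<Sum>a<N. \<Sum>b<N. of_real (g r) * F r a b * G b a)) has_integral trp N Fint G) {0..1}"
    by (simp add: trp_def o_def)
  also have "(\<lambda>r. Re (\<Sum>a<N. \<Sum>b<N. of_real (g r) * F r a b * G b a)) = (\<lambda>r. g r * trp N (F r) G)"
  proof
    fix r
    have "(\<Sum>a<N. \<Sum>b<N. of_real (g r) * F r a b * G b a) = of_real (g r) * (\<Sum>a<N. \<Sum>b<N. F r a b * G b a)"
      by (simp add: sum_distrib_left mult.assoc)
    then show "Re (\<Sum>a<N. \<Sum>b<N. of_real (g r) * F r a b * G b a) = g r * trp N (F r) G"
      by (simp add: trp_def)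
  qed
  finally show ?thesis .
qed

text \<open>The relative entropy is an integral over \<open>r\<close> of \<open>(1 - r) \<langle>D, (r L + (1 - r) R)\<inverse> D\<rangle>\<close>, where
  \<open>D = T - Y\<close> and \<open>L\<close>, \<open>R\<close> are left multiplication by \<open>T\<close> and right multiplication by \<open>Y\<close>. The
  integrand is the supremum over all matrices \<open>Z\<close> of functions linear in \<open>(T, Y)\<close>; integrating the
  maximisers for \<open>(T0, Y0)\<close> gives a linear functional that supports the relative entropy there.\<close>

lemma rel_entropy_support:
  assumes u0: "onb N u0" and v0: "onb N v0"
    and t0: "\<And>i. i < N \<Longrightarrow> t0 i > 0" and y0: "\<And>i. i < N \<Longrightarrow> y0 i > 0"
  obtains P Q where
    "trp N P (hfun N (\<lambda>x. x) t0 u0) + trp N Q (hfun N (\<lambda>x. x) y0 v0) = rel_entropy N t0 u0 y0 v0"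
    "\<And>t u y v. onb N u \<Longrightarrow> onb N v \<Longrightarrow> (\<And>i. i < N \<Longrightarrow> t i > 0) \<Longrightarrow> (\<And>i. i < N \<Longrightarrow> y i > 0) \<Longrightarrow>
       trp N P (hfun N (\<lambda>x. x) t u) + trp N Q (hfun N (\<lambda>x. x) y v) \<le> rel_entropy N t u y v"
    "\<And>Y. herm N Y \<Longrightarrow> (\<And>x. qf N Y x \<ge> 0) \<Longrightarrow> trp N Q Y \<le> mtr N Y"
proof -
  \<comment> \<open>The point d / q times c at which \<open>complete_square\<close> is an equality,
    for the pair (i, j) of the base matrices.\<close>
  define z where "z r = (\<lambda>i j. of_real ((t0 i - y0 j) / (r * t0 i + (1 - r) * y0 j)) * ip N (u0 i) (v0 j))" for r
  define Z where "Z r = zmat N u0 v0 (z r)" for r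
  \<comment> \<open>Positivity of the denominators on the whole closed interval gives continuity in
    \<open>r\<close>, and with it the integrals that define \<open>P\<close> and
    \<open>Q\<close>.\<close>
  have contZ: "continuous_on {0..1} (\<lambda>r. Z r a b)" for a b
  proof -
    have "\<forall>r\<in>{0..1}. complex_of_real r * of_real (t0 i) + (1 - of_real r) * of_real (y0 j) \<noteq> 0"
      if "i < N" "j < N" for i j
    proof
      fix r :: real assume "r \<in> {0..1}"
      from segment_pos[OF t0[OF that(1)] y0[OF that(2)] this]
      have "complex_of_real (r * t0 i + (1 - r) * y0 j) \<noteq> 0"
        unfolding of_real_eq_0_iff by simp
      then show "complex_of_real r * of_real (t0 i) + (1 - of_real r) * of_real (y0 j) \<noteq> 0"
        by simp
    qed
    then show ?thesis
      unfolding Z_def zmat_def z_def by (auto intro!: continuous_intros)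
  qed
  define P where "P = (\<lambda>a b. integral {0..1} (\<lambda>r. of_real (1 - r) * coefT N r (Z r) a b))"
  define Q where "Q = (\<lambda>a b. integral {0..1} (\<lambda>r. of_real (1 - r) * coefY N r (Z r) a b))"
  have P: "((\<lambda>r. (1 - r) * trp N (coefT N r (Z r)) G) has_integral trp N P G) {0..1}" for G
    unfolding P_def
    by (intro has_integral_trp integrable_integral integrable_continuous_real)
      (auto intro!: continuous_intros contZ simp: coefT_def adj_def mmul_def)
  have Q: "((\<lambda>r. (1 - r) * trp N (coefY N r (Z r)) G) has_integral trp N Q G) {0..1}" for G
    unfolding Q_def
    by (intro has_integral_trp integrable_integral integrable_continuous_real)
      (auto intro!: continuous_intros contZ simp: coefY_def adj_def mmul_def)
  have PQ: "((\<lambda>r. (1 - r) * (trp N (coefT N r (Z r)) F + trp N (coefY N r (Z r)) G)) has_integral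
      trp N P F + trp N Q G) {0..1}" for F G
    unfolding distrib_left by (intro has_integral_add P Q)
  have D: "((\<lambda>r. \<Sum>i<N. \<Sum>j<N. overlap N u v i j * ((1 - r) * ((t i - y j)\<^sup>2 / (r * t i + (1 - r) * y j))))
      has_integral rel_entropy N t u y v) {0..1}"
    if "\<And>i. i < N \<Longrightarrow> t i > 0" "\<And>i. i < N \<Longrightarrow> y i > 0" for t u y v
    unfolding rel_entropy_def using that
    by (intro has_integral_sum has_integral_mult_right rel_entropy_integral_scalar) auto
  show ?thesis
  proof (rule that)
    have "(1 - r) * (trp N (coefT N r (Z r)) (hfun N (\<lambda>x. x) t0 u0) + trp N (coefY N r (Z r)) (hfun N (\<lambda>x. x) y0 v0))
      = (\<Sum>i<N. \<Sum>j<N. overlap N u0 v0 i j * ((1 - r) * ((t0 i - y0 j)\<^sup>2 / (r * t0 i + (1 - r) * y0 j))))"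
      if r: "r \<in> {0..1}" for r
      unfolding coef_expand[OF u0 v0] sum_distrib_left
    proof (intro sum.cong refl)
      fix i j assume "i \<in> {..<N}" "j \<in> {..<N}"
      then have ij: "i < N" "j < N" by auto
      have z: "ip N (u0 i) (mv N (Z r) (v0 j)) = z r i j"
        unfolding Z_def by (rule ip_mv_zmat[OF u0 v0 ij])
      have eq: "2 * (t0 i - y0 j) * Re (ip N (u0 i) (v0 j) * cnj (z r i j))
          - (r * t0 i + (1 - r) * y0 j) * (cmod (z r i j))\<^sup>2
        = (t0 i - y0 j)\<^sup>2 / (r * t0 i + (1 - r) * y0 j) * (cmod (ip N (u0 i) (v0 j)))\<^sup>2"
        by (rule complete_square(2)[OF segment_pos[OF t0[OF ij(1)] y0[OF ij(2)] r]]) (simp only: z_def)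
      show "(1 - r) * (2 * (t0 i - y0 j) * Re (ip N (u0 i) (v0 j) * cnj (ip N (u0 i) (mv N (Z r) (v0 j))))
          - (r * t0 i + (1 - r) * y0 j) * (cmod (ip N (u0 i) (mv N (Z r) (v0 j))))\<^sup>2)
        = overlap N u0 v0 i j * ((1 - r) * ((t0 i - y0 j)\<^sup>2 / (r * t0 i + (1 - r) * y0 j)))"
        unfolding z eq by (simp add: overlap_def mult_ac)
    qed
    then show "trp N P (hfun N (\<lambda>x. x) t0 u0) + trp N Q (hfun N (\<lambda>x. x) y0 v0) = rel_entropy N t0 u0 y0 v0"
      by (intro has_integral_unique[OF has_integral_eq[OF _ PQ] D] t0 y0) auto
  next
    fix t y :: "nat \<Rightarrow> real" and u v
    assume u: "onb N u" and v: "onb N v" and t: "\<And>i. i < N \<Longrightarrow> t i > 0" and y: "\<And>i. i < N \<Longrightarrow> y i > 0"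
    show "trp N P (hfun N (\<lambda>x. x) t u) + trp N Q (hfun N (\<lambda>x. x) y v) \<le> rel_entropy N t u y v"
    proof (rule has_integral_le[OF PQ D])
      fix r :: real assume r: "r \<in> {0..1}"
      show "(1 - r) * (trp N (coefT N r (Z r)) (hfun N (\<lambda>x. x) t u) + trp N (coefY N r (Z r)) (hfun N (\<lambda>x. x) y v))
        \<le> (\<Sum>i<N. \<Sum>j<N. overlap N u v i j * ((1 - r) * ((t i - y j)\<^sup>2 / (r * t i + (1 - r) * y j))))"
        unfolding coef_expand[OF u v] sum_distrib_left
      proof (intro sum_mono)
        fix i j assume "i \<in> {..<N}" "j \<in> {..<N}"
        then have ij: "i < N" "j < N" by auto
        have "(1 - r) * (2 * (t i - y j) * Re (ip N (u i) (v j) * cnj (ip N (u i) (mv N (Z r) (v j))))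
            - (r * t i + (1 - r) * y j) * (cmod (ip N (u i) (mv N (Z r) (v j))))\<^sup>2)
          \<le> (1 - r) * ((t i - y j)\<^sup>2 / (r * t i + (1 - r) * y j) * (cmod (ip N (u i) (v j)))\<^sup>2)"
          using r by (intro mult_left_mono complete_square(1) segment_pos t y ij) auto
        then show "(1 - r) * (2 * (t i - y j) * Re (ip N (u i) (v j) * cnj (ip N (u i) (mv N (Z r) (v j))))
            - (r * t i + (1 - r) * y j) * (cmod (ip N (u i) (mv N (Z r) (v j))))\<^sup>2)
          \<le> overlap N u v i j * ((1 - r) * ((t i - y j)\<^sup>2 / (r * t i + (1 - r) * y j)))"
          by (simp add: overlap_def mult_ac)
      qed
    qed (use t y in auto)
  next
    fix Y assume Y: "herm N Y" and psd: "\<And>x. qf N Y x \<ge> 0"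
    let ?l = "eigs N Y" and ?v = "evecs N Y"
    \<comment> \<open>The identity minus the Hermitian part of (1 - r) \<open>coefY\<close> equals
      (1 + (1 - r) Z)* (1 + (1 - r) Z), hence is positive semidefinite. Integrating over
      \<open>r\<close> keeps the coefficient \<open>Q\<close> below the identity.\<close>
    have le1: "(1 - r) * qf N (coefY N r (Z r)) x \<le> Re (ip N x x)" for r x
    proof -
      have "0 \<le> Re (ip N (\<lambda>a. x a + of_real (1 - r) * mv N (Z r) x a) (\<lambda>a. x a + of_real (1 - r) * mv N (Z r) x a))"
        by (rule ip_self_nonneg)
      moreover have "Re (ip N (mv N (Z r) x) x) = Re (ip N x (mv N (Z r) x))"
        by (rule Re_ip_commute)
      ultimately show ?thesis
        unfolding ip_add_left ip_add_right ip_scale_left ip_scale_right qf_coefY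
        by (simp add: algebra_simps)
    qed
    have tr: "mtr N Y = (\<Sum>j<N. ?l j)"
      using mtr_hfun[OF onb_evecs[OF Y], of "\<lambda>x. x"] herm_hfun_eigs[OF Y] by (simp cong: mtr_cong)
    have "(1 - r) * trp N (coefY N r (Z r)) Y \<le> mtr N Y" for r
    proof -
      have "trp N (coefY N r (Z r)) Y = trp N (coefY N r (Z r)) (hfun N (\<lambda>x. x) ?l ?v)"
        by (rule trp_cong) (simp_all add: herm_hfun_eigs[OF Y])
      then have "(1 - r) * trp N (coefY N r (Z r)) Y = (\<Sum>j<N. ?l j * ((1 - r) * qf N (coefY N r (Z r)) (?v j)))"
        by (simp add: trp_hfun_right sum_distrib_left mult_ac)
      also have "\<dots> \<le> (\<Sum>j<N. ?l j * Re (ip N (?v j) (?v j)))"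
        using psd by (intro sum_mono mult_left_mono le1) (simp_all add: eigs_eq_qf[OF Y])
      also have "\<dots> = mtr N Y"
        using onbD[OF onb_evecs[OF Y]] by (simp add: tr)
      finally show ?thesis .
    qed
    moreover have "((\<lambda>r. mtr N Y) has_integral mtr N Y) {0..1::real}"
      using has_integral_const_real[of "mtr N Y" 0 1] by simp
    ultimately show "trp N Q Y \<le> mtr N Y"
      by (intro has_integral_le[OF Q]) auto
  qed
qed

section \<open>Trace exponentials of sums of independent matrices\<close>

lemma trp_commute: "trp N F G = trp N G F"
  unfolding trp_def by (subst sum.swap) (simp add: mult.commute)

lemma trp_diff_right: "trp N F (\<lambda>a b. A a b - B a b) = trp N F A - trp N F B"
  by (simp add: trp_def right_diff_distrib sum_subtractf)

text \<open>A quadratic form is a trace against the rank-one matrix v v*, so linearity and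
  integration need to be treated for \<open>trp\<close> only.\<close>

lemma qf_trp: "qf N F v = trp N (\<lambda>a b. v a * cnj (v b)) F"
proof -
  have "qf N F v = Re (\<Sum>a<N. \<Sum>b<N. v b * cnj (v a) * F a b)"
    by (simp add: qf_def ip_def mv_def sum_distrib_left mult_ac)
  then show ?thesis
    unfolding trp_def by (subst (asm) sum.swap)
qed

lemma mtr_trp: "mtr N F = trp N (\<lambda>a b. if a = b then 1 else 0) F"
  by (simp add: mtr_def trp_def if_distrib if_distribR cong: if_cong)

lemma trp_abs_le:
  assumes "\<And>a b. a < N \<Longrightarrow> b < N \<Longrightarrow> cmod (F a b) \<le> K"
  shows "trp N F H \<le> (\<Sum>a<N. \<Sum>b<N. cmod (H a b)) * K"
proof -
  have "trp N F H \<le> cmod (\<Sum>a<N. \<Sum>b<N. F a b * H b a)"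
    unfolding trp_def by (rule complex_Re_le_cmod)
  also have "\<dots> \<le> (\<Sum>a<N. \<Sum>b<N. cmod (F a b * H b a))"
    by (intro order_trans[OF norm_sum] sum_mono) simp
  also have "\<dots> \<le> (\<Sum>a<N. \<Sum>b<N. cmod (H b a) * K)"
    using assms by (intro sum_mono) (simp add: norm_mult mult.commute mult_right_mono)
  also have "\<dots> = (\<Sum>a<N. \<Sum>b<N. cmod (H a b)) * K"
    by (subst sum.swap) (simp add: sum_distrib_right)
  finally show ?thesis .
qed

lemma has_bochner_integral_trp:
  assumes "\<And>a b. a < N \<Longrightarrow> b < N \<Longrightarrow> integrable M (\<lambda>x. F x a b)"
  shows "has_bochner_integral M (\<lambda>x. trp N P (F x)) (trp N P (\<lambda>a b. \<integral>x. F x a b \<partial>M))"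
  unfolding trp_def using assms
  by (intro has_bochner_integral_Re has_bochner_integral_sum has_bochner_integral_mult_right
      has_bochner_integral_integrable) auto

lemmas integrable_trp = has_bochner_integral_trp[THEN integrable.intros]
lemmas integral_trp = has_bochner_integral_trp[THEN has_bochner_integral_integral_eq]

lemma integral_qf:
  assumes "\<And>a b. a < N \<Longrightarrow> b < N \<Longrightarrow> integrable M (\<lambda>x. F x a b)"
  shows "integrable M (\<lambda>x. qf N (F x) v)"
    and "(\<integral>x. qf N (F x) v \<partial>M) = qf N (\<lambda>a b. \<integral>x. F x a b \<partial>M) v"
  unfolding qf_trp by (rule integrable_trp integral_trp, rule assms, assumption+)+

lemma integral_mtr:
  assumes "\<And>a b. a < N \<Longrightarrow> b < N \<Longrightarrow> integrable M (\<lambda>x. F x a b)"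
  shows "(\<integral>x. mtr N (F x) \<partial>M) = mtr N (\<lambda>a b. \<integral>x. F x a b \<partial>M)"
  unfolding mtr_trp using assms by (rule integral_trp)

lemma measurable_mpow:
  assumes "\<And>a b. a < N \<Longrightarrow> b < N \<Longrightarrow> (\<lambda>x. R x a b) \<in> borel_measurable M"
  shows "a < N \<Longrightarrow> b < N \<Longrightarrow> (\<lambda>x. mpow N (R x) k a b) \<in> borel_measurable M"
  by (induction k arbitrary: a) (auto simp: mmul_def intro!: borel_measurable_sum borel_measurable_times assms)

lemma measurable_mexp:
  assumes herm: "\<And>x. x \<in> space M \<Longrightarrow> herm N (R x)"
    and meas: "\<And>a b. a < N \<Longrightarrow> b < N \<Longrightarrow> (\<lambda>x. R x a b) \<in> borel_measurable M"
    and ab: "a < N" "b < N"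
  shows "(\<lambda>x. mexp N (R x) a b) \<in> borel_measurable M"
proof (rule borel_measurable_LIMSEQ_metric)
  show "(\<lambda>x. \<Sum>k<n. mpow N (R x) k a b / fact k) \<in> borel_measurable M" for n
    using measurable_mpow[OF meas ab] by (intro borel_measurable_sum borel_measurable_divide) auto
  show "(\<lambda>n. \<Sum>k<n. mpow N (R x) k a b / fact k) \<longlonglongrightarrow> mexp N (R x) a b" if "x \<in> space M" for x
    using mpow_sums_mexp[OF herm[OF that] ab] by (simp add: sums_def)
qed

lemma measurable_tr_exp:
  assumes "\<And>x. x \<in> space M \<Longrightarrow> herm N (R x)"
    and "\<And>a b. a < N \<Longrightarrow> b < N \<Longrightarrow> (\<lambda>x. R x a b) \<in> borel_measurable M"
  shows "(\<lambda>x. tr_exp N (R x)) \<in> borel_measurable M"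
  unfolding tr_exp_def mtr_def
  by (intro borel_measurable_Re[THEN measurable_compose[rotated]] borel_measurable_sum measurable_mexp assms)
    auto

lemma hermI: "(\<And>a b. a < N \<Longrightarrow> b < N \<Longrightarrow> cnj (A a b) = A b a) \<Longrightarrow> herm N A"
  by (simp add: herm_def)

lemma herm_hfun: "herm N (hfun N f l u)"
  by (simp add: herm_def hfun_def mult.commute)

lemma herm_mexp: "herm N (mexp N B)"
  unfolding mexp_def by (rule herm_hfun)

lemma herm_add: "herm N A \<Longrightarrow> herm N B \<Longrightarrow> herm N (\<lambda>a b. A a b + B a b)"
  by (rule hermI) (simp add: hermD)

lemma herm_diff: "herm N A \<Longrightarrow> herm N B \<Longrightarrow> herm N (\<lambda>a b. A a b - B a b)"
  by (rule hermI) (simp add: hermD)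

lemma herm_integral:
  assumes "\<And>x. x \<in> space M \<Longrightarrow> herm N (F x)"
  shows "herm N (\<lambda>a b. \<integral>x. F x a b \<partial>M)"
  unfolding herm_def
proof (intro allI impI)
  fix a b assume "a < N" "b < N"
  then have "(\<integral>x. F x b a \<partial>M) = (\<integral>x. cnj (F x a b) \<partial>M)"
    by (intro Bochner_Integration.integral_cong refl) (simp add: hermD[OF assms])
  then show "(\<integral>x. F x b a \<partial>M) = cnj (\<integral>x. F x a b \<partial>M)"
    by simp
qed

section \<open>Exchanging random exponents for deterministic ones\<close>

lemma tr_exp_nonneg: "herm N B \<Longrightarrow> tr_exp N B \<ge> 0"
  by (simp add: tr_exp_eigs sum_nonneg)

text \<open>A crude bound that serves integrability only. Gibbs' principle is applied to exp (H + R)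
  with the exponent \<open>R\<close> shifted by \<open>c\<close>; the shift absorbs tr (exp (H + R)
  H), because the entries of exp (H + R) are bounded by its trace.\<close>

lemma tr_exp_add_le:
  assumes H: "herm N H" and R: "herm N R"
  shows "tr_exp N (\<lambda>a b. H a b + R a b) \<le> exp (\<Sum>a<N. \<Sum>b<N. cmod (H a b)) * tr_exp N R"
proof -
  define S where "S = (\<lambda>a b. H a b + R a b)"
  define c where "c = (\<Sum>a<N. \<Sum>b<N. cmod (H a b))"
  have S: "herm N S"
    unfolding S_def by (intro herm_add H R)
  have "trp N (mexp N S) R + c * tr_exp N S - trp N (mexp N S) S + tr_exp N S \<le> exp c * tr_exp N R"
    using gibbs_variational[OF onb_evecs[OF S] _ R, where t = "\<lambda>i. exp (eigs N S i)" and c = c]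
    by (simp add: mexp_hfun_id[symmetric] trp_mexp_self[OF S] tr_exp_eigs[OF S])
  moreover have "trp N (mexp N S) S = trp N (mexp N S) H + trp N (mexp N S) R"
    by (subst (2) S_def) (rule trp_add_right)
  moreover have "trp N (mexp N S) H \<le> c * tr_exp N S"
    unfolding c_def by (intro trp_abs_le norm_mexp_le S)
  ultimately show ?thesis
    unfolding c_def[symmetric] S_def[symmetric] by linarith
qed

text \<open>This replaces the appeal to Lieb's concavity theorem: the supporting functional of the relative
  entropy at \<open>(E exp (H + R), exp G)\<close> is averaged over the distribution of \<open>R\<close>, and Gibbs' variational
  principle is applied to \<open>E exp (H + R)\<close>.\<close>

lemma lieb_step:
  assumes M: "prob_space M" and H: "herm N H" and G: "herm N G"
    and R: "\<And>x. x \<in> space M \<Longrightarrow> herm N (R x)"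
    and meas: "\<And>a b. a < N \<Longrightarrow> b < N \<Longrightarrow> (\<lambda>x. R x a b) \<in> borel_measurable M"
    and int: "integrable M (\<lambda>x. tr_exp N (R x))"
    and dom: "\<And>v. (\<integral>x. qf N (mexp N (R x)) v \<partial>M) \<le> qf N (mexp N G) v"
  shows "integrable M (\<lambda>x. tr_exp N (\<lambda>a b. H a b + R x a b))"
    and "(\<integral>x. tr_exp N (\<lambda>a b. H a b + R x a b) \<partial>M) \<le> tr_exp N (\<lambda>a b. H a b + G a b)"
proof -
  interpret prob_space M by fact
  define S where "S x = (\<lambda>a b. H a b + R x a b)" for x
  have S: "herm N (S x)" if "x \<in> space M" for x
    unfolding S_def by (intro herm_add H R that)
  have measS: "(\<lambda>x. S x a b) \<in> borel_measurable M" if "a < N" "b < N" for a b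
    unfolding S_def using meas[OF that] by simp
  show intS: "integrable M (\<lambda>x. tr_exp N (\<lambda>a b. H a b + R x a b))"
  proof (rule Bochner_Integration.integrable_bound)
    show "integrable M (\<lambda>x. exp (\<Sum>a<N. \<Sum>b<N. cmod (H a b)) * tr_exp N (R x))"
      using int by simp
    show "(\<lambda>x. tr_exp N (\<lambda>a b. H a b + R x a b)) \<in> borel_measurable M"
      using measurable_tr_exp[OF S measS] by (simp add: S_def)
    show "AE x in M. norm (tr_exp N (\<lambda>a b. H a b + R x a b))
        \<le> norm (exp (\<Sum>a<N. \<Sum>b<N. cmod (H a b)) * tr_exp N (R x))"
    proof (rule AE_I2)
      fix x assume x: "x \<in> space M"
      show "norm (tr_exp N (\<lambda>a b. H a b + R x a b)) \<le> norm (exp (\<Sum>a<N. \<Sum>b<N. cmod (H a b)) * tr_exp N (R x))"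
        using tr_exp_add_le[OF H R[OF x]] tr_exp_nonneg[OF S[OF x]] tr_exp_nonneg[OF R[OF x]]
        by (simp add: S_def)
    qed
  qed
  have int_mexp: "integrable M (\<lambda>x. mexp N (F x) a b)"
    if "\<And>x. x \<in> space M \<Longrightarrow> herm N (F x)" "\<And>a b. a < N \<Longrightarrow> b < N \<Longrightarrow> (\<lambda>x. F x a b) \<in> borel_measurable M"
      "integrable M (\<lambda>x. tr_exp N (F x))" "a < N" "b < N" for F a b
    by (rule Bochner_Integration.integrable_bound[OF that(3) measurable_mexp[OF that(1,2,4,5)]])
      (use that norm_mexp_le tr_exp_nonneg in \<open>auto intro!: AE_I2\<close>)
  have intmS: "integrable M (\<lambda>x. mexp N (S x) a b)" if "a < N" "b < N" for a b
    using int_mexp[OF S measS] intS that unfolding S_def by blast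
  have intmR: "integrable M (\<lambda>x. mexp N (R x) a b)" if "a < N" "b < N" for a b
    using int_mexp[OF R meas] int that by blast
  define Tb where "Tb = (\<lambda>a b. \<integral>x. mexp N (S x) a b \<partial>M)"
  define Yb where "Yb = (\<lambda>a b. \<integral>x. mexp N (R x) a b \<partial>M)"
  have Tb: "herm N Tb" and Yb: "herm N Yb"
    unfolding Tb_def Yb_def by (intro herm_integral herm_mexp)+
  define t where "t = eigs N Tb"
  define u where "u = evecs N Tb"
  have u: "onb N u"
    unfolding u_def by (rule onb_evecs[OF Tb])
  have Tb_eq: "trp N (hfun N (\<lambda>x. x) t u) F = trp N Tb F" "trp N F (hfun N (\<lambda>x. x) t u) = trp N F Tb" for F
    unfolding t_def u_def by (rule trp_cong; simp add: herm_hfun_eigs[OF Tb])+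
  \<comment> \<open>The supporting functional is available only at positive definite base points.
    Each eigenvalue of \<open>Tb\<close> is the mean of a quadratic form of exp (S x) at a unit
    vector, which is positive everywhere.\<close>
  have t: "t i > 0" if "i < N" for i
  proof -
    have "(\<integral>x. 0 \<partial>M) < (\<integral>x. qf N (mexp N (S x)) (u i) \<partial>M)"
    proof (rule integral_less_AE_space)
      show "AE x in M. 0 < qf N (mexp N (S x)) (u i)"
        using onbD[OF u that that] by (intro AE_I2 qf_mexp_pos S) auto
      show "integrable M (\<lambda>x. qf N (mexp N (S x)) (u i))"
        by (rule integral_qf(1)[OF intmS])
    qed (simp_all add: emeasure_space_1)
    also have "\<dots> = t i"
      using eigs_eq_qf[OF Tb that] integral_qf(2)[OF intmS] by (simp add: Tb_def t_def u_def)
    finally show ?thesis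
      by simp
  qed
  obtain P Q where
    PQ_eq: "trp N P (hfun N (\<lambda>x. x) t u) + trp N Q (hfun N (\<lambda>x. x) (\<lambda>j. exp (eigs N G j)) (evecs N G))
        = rel_entropy N t u (\<lambda>j. exp (eigs N G j)) (evecs N G)" and
    PQ_le: "\<And>t u y v. onb N u \<Longrightarrow> onb N v \<Longrightarrow> (\<And>i. i < N \<Longrightarrow> t i > 0) \<Longrightarrow> (\<And>i. i < N \<Longrightarrow> y i > 0) \<Longrightarrow>
       trp N P (hfun N (\<lambda>x. x) t u) + trp N Q (hfun N (\<lambda>x. x) y v) \<le> rel_entropy N t u y v" and
    Q_le: "\<And>Y. herm N Y \<Longrightarrow> (\<And>x. qf N Y x \<ge> 0) \<Longrightarrow> trp N Q Y \<le> mtr N Y"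
    by (rule rel_entropy_support[OF u onb_evecs[OF G] t, where ?y0.0 = "\<lambda>j. exp (eigs N G j)"]) auto
  have "trp N P Tb + trp N Q Yb = (\<integral>x. trp N P (mexp N (S x)) + trp N Q (mexp N (R x)) \<partial>M)"
  proof -
    have "trp N P Tb = (\<integral>x. trp N P (mexp N (S x)) \<partial>M)"
      unfolding Tb_def by (rule integral_trp[symmetric]) (rule intmS)
    moreover have "trp N Q Yb = (\<integral>x. trp N Q (mexp N (R x)) \<partial>M)"
      unfolding Yb_def by (rule integral_trp[symmetric]) (rule intmR)
    moreover have "integrable M (\<lambda>x. trp N P (mexp N (S x)))" "integrable M (\<lambda>x. trp N Q (mexp N (R x)))"
      by (intro integrable_trp intmS intmR; assumption)+
    ultimately show ?thesis
      by simp
  qed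
  also have "\<dots> \<le> (\<integral>x. trp N H (mexp N (S x)) - tr_exp N (S x) + tr_exp N (R x) \<partial>M)"
  proof (rule integral_mono)
    show "integrable M (\<lambda>x. trp N P (mexp N (S x)) + trp N Q (mexp N (R x)))"
      by (intro Bochner_Integration.integrable_add integrable_trp intmS intmR)
    show "integrable M (\<lambda>x. trp N H (mexp N (S x)) - tr_exp N (S x) + tr_exp N (R x))"
      using intS int unfolding S_def[symmetric]
      by (intro Bochner_Integration.integrable_add Bochner_Integration.integrable_diff integrable_trp intmS)
    fix x assume x: "x \<in> space M"
    \<comment> \<open>The functional lies below the relative entropy of exp (S x) with respect to
      exp (R x). As S - R = H, that entropy is tr (exp S H) - tr exp S + tr exp R.\<close>
    have "trp N P (mexp N (S x)) + trp N Q (mexp N (R x)) \<le>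
        (\<Sum>i<N. exp (eigs N (S x) i) * eigs N (S x) i) - trp N (mexp N (S x)) (R x)
        - (\<Sum>i<N. exp (eigs N (S x) i)) + tr_exp N (R x)"
      using PQ_le[OF onb_evecs[OF S[OF x]] onb_evecs[OF R[OF x]],
          of "\<lambda>i. exp (eigs N (S x) i)" "\<lambda>i. exp (eigs N (R x) i)"]
      by (simp add: rel_entropy_mexp[OF onb_evecs[OF S[OF x]] R[OF x]] mexp_hfun_id[symmetric])
    also have "\<dots> = trp N (mexp N (S x)) (S x) - trp N (mexp N (S x)) (R x) - tr_exp N (S x) + tr_exp N (R x)"
      by (simp add: trp_mexp_self[OF S[OF x]] tr_exp_eigs[OF S[OF x]])
    also have "trp N (mexp N (S x)) (S x) = trp N (mexp N (S x)) H + trp N (mexp N (S x)) (R x)"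
      by (subst (2) S_def) (rule trp_add_right)
    finally show "trp N P (mexp N (S x)) + trp N Q (mexp N (R x))
        \<le> trp N H (mexp N (S x)) - tr_exp N (S x) + tr_exp N (R x)"
      by (simp add: trp_commute)
  qed
  also have "\<dots> = trp N H Tb - (\<integral>x. tr_exp N (S x) \<partial>M) + mtr N Yb"
    using intS int integrable_trp[OF intmS, where P = H] integral_trp[OF intmS, where P = H] integral_mtr[OF intmR]
    unfolding S_def[symmetric] by (simp add: Tb_def Yb_def tr_exp_def)
  finally have A: "trp N P Tb + trp N Q Yb \<le> trp N H Tb - (\<integral>x. tr_exp N (S x) \<partial>M) + mtr N Yb" .
  \<comment> \<open>This is where the domination of the mean exponential by exp G enters: the
    difference is positive semidefinite, and \<open>Q\<close> is at most the identity on such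
    matrices.\<close>
  have "trp N Q (\<lambda>a b. mexp N G a b - Yb a b) \<le> mtr N (\<lambda>a b. mexp N G a b - Yb a b)"
  proof (rule Q_le)
    show "herm N (\<lambda>a b. mexp N G a b - Yb a b)"
      by (intro herm_diff herm_mexp Yb)
    show "0 \<le> qf N (\<lambda>a b. mexp N G a b - Yb a b) v" for v
      using dom[of v] integral_qf(2)[OF intmR, where v = v]
      by (simp add: Yb_def qf_trp trp_diff_right)
  qed
  then have B: "trp N Q (mexp N G) - trp N Q Yb \<le> tr_exp N G - mtr N Yb"
    by (simp add: trp_diff_right mtr_trp tr_exp_def)
  \<comment> \<open>The functional touches the relative entropy at (Tb, exp G). This equality turns
    the averaged lower bound into an entropy that Gibbs' principle at the single matrix
    \<open>Tb\<close> can bound.\<close>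
  have C: "trp N P Tb + trp N Q (mexp N G) = (\<Sum>i<N. t i * ln (t i)) - trp N Tb G - (\<Sum>i<N. t i) + tr_exp N G"
    using PQ_eq by (simp add: rel_entropy_mexp[OF u G] Tb_eq mexp_hfun_id)
  have "trp N Tb (\<lambda>a b. H a b + G a b) - (\<Sum>i<N. t i * ln (t i)) + (\<Sum>i<N. t i)
      \<le> tr_exp N (\<lambda>a b. H a b + G a b)"
    using gibbs_variational[where t = t and c = 0, OF u t herm_add[OF H G]] by (simp add: Tb_eq)
  then have "trp N H Tb + trp N Tb G - (\<Sum>i<N. t i * ln (t i)) + (\<Sum>i<N. t i)
      \<le> tr_exp N (\<lambda>a b. H a b + G a b)"
    by (simp add: trp_add_right trp_commute[of N H])
  with A B C show "(\<integral>x. tr_exp N (\<lambda>a b. H a b + R x a b) \<partial>M) \<le> tr_exp N (\<lambda>a b. H a b + G a b)"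
    unfolding S_def[symmetric] by linarith
qed

lemma herm_sum: "(\<And>i. i \<in> I \<Longrightarrow> herm N (F i)) \<Longrightarrow> herm N (\<lambda>a b. \<Sum>i\<in>I. F i a b)"
  by (rule hermI) (auto intro!: sum.cong hermD)

text \<open>Coordinate \<open>j\<close> is integrated out while the others are frozen, and its
  substitute \<open>G j\<close> joins the fixed matrix \<open>H\<close>; hence the induction has to
  hold for arbitrary \<open>H\<close>. With nonnegative integrals, iterated integration asks for
  measurability alone.\<close>

lemma tr_exp_iterate:
  assumes "finite I" and Q: "\<And>i. prob_space (Q i)"
    and G: "\<And>i. i \<in> I \<Longrightarrow> herm N (G i)"
    and R: "\<And>i x. i \<in> I \<Longrightarrow> x \<in> space (Q i) \<Longrightarrow> herm N (R i x)"
    and meas: "\<And>i a b. i \<in> I \<Longrightarrow> a < N \<Longrightarrow> b < N \<Longrightarrow> (\<lambda>x. R i x a b) \<in> borel_measurable (Q i)"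
    and int: "\<And>i. i \<in> I \<Longrightarrow> integrable (Q i) (\<lambda>x. tr_exp N (R i x))"
    and dom: "\<And>i v. i \<in> I \<Longrightarrow> (\<integral>x. qf N (mexp N (R i x)) v \<partial>Q i) \<le> qf N (mexp N (G i)) v"
    and H: "herm N H"
  shows "(\<integral>\<^sup>+x. ennreal (tr_exp N (\<lambda>a b. H a b + (\<Sum>i\<in>I. R i (x i) a b))) \<partial>PiM I Q)
    \<le> ennreal (tr_exp N (\<lambda>a b. H a b + (\<Sum>i\<in>I. G i a b)))"
  using assms(1) G R meas int dom H
proof (induction I arbitrary: H rule: finite_induct)
  interpret product_prob_space Q
    by (intro product_prob_spaceI Q)
  case empty
  show ?case
    by (simp add: PiM_empty)
next
  interpret product_prob_space Q
    by (intro product_prob_spaceI Q)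
  case (insert j I)
  let ?f = "\<lambda>x. ennreal (tr_exp N (\<lambda>a b. H a b + (\<Sum>i\<in>insert j I. R i (x i) a b)))"
  have "?f \<in> borel_measurable (PiM (insert j I) Q)"
  proof (intro measurable_compose[OF _ measurable_ennreal] measurable_tr_exp)
    show "herm N (\<lambda>a b. H a b + (\<Sum>i\<in>insert j I. R i (x i) a b))"
      if "x \<in> space (PiM (insert j I) Q)" for x
      using that by (intro herm_add herm_sum insert.prems) (auto simp: space_PiM)
    show "(\<lambda>x. H a b + (\<Sum>i\<in>insert j I. R i (x i) a b)) \<in> borel_measurable (PiM (insert j I) Q)"
      if "a < N" "b < N" for a b
    proof (intro borel_measurable_add borel_measurable_const borel_measurable_sum)
      fix i assume i: "i \<in> insert j I"
      have "(\<lambda>x. x i) \<in> measurable (PiM (insert j I) Q) (Q i)"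
        using i by (rule measurable_component_singleton)
      from measurable_compose[OF this insert.prems(3)[OF i that]]
      show "(\<lambda>x. R i (x i) a b) \<in> borel_measurable (PiM (insert j I) Q)" .
    qed
  qed
  then have "(\<integral>\<^sup>+x. ?f x \<partial>PiM (insert j I) Q) = (\<integral>\<^sup>+x. \<integral>\<^sup>+y. ?f (x(j := y)) \<partial>Q j \<partial>PiM I Q)"
    by (intro product_nn_integral_insert insert.hyps)
  also have "\<dots> \<le> (\<integral>\<^sup>+x. ennreal (tr_exp N (\<lambda>a b. (H a b + G j a b) + (\<Sum>i\<in>I. R i (x i) a b))) \<partial>PiM I Q)"
  proof (rule nn_integral_mono)
    fix x assume x: "x \<in> space (PiM I Q)"
    \<comment> \<open>All that is constant in the coordinate \<open>j\<close>; it plays the part of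
      the fixed matrix in the exchange step.\<close>
    define K where "K = (\<lambda>a b. H a b + (\<Sum>i\<in>I. R i (x i) a b))"
    have K: "herm N K"
      unfolding K_def using x by (intro herm_add herm_sum insert.prems) (auto simp: space_PiM)
    have f: "?f (x(j := y)) = ennreal (tr_exp N (\<lambda>a b. K a b + R j y a b))" for y
    proof -
      have "(\<Sum>i\<in>I. R i ((x(j := y)) i) a b) = (\<Sum>i\<in>I. R i (x i) a b)" for a b
        using insert.hyps by (intro sum.cong) auto
      then show ?thesis
        using insert.hyps by (simp add: K_def add_ac)
    qed
    have j: "j \<in> insert j I"
      by simp
    note step = lieb_step[OF Q K insert.prems(1)[OF j] insert.prems(2)[OF j] insert.prems(3)[OF j]
        insert.prems(4)[OF j] insert.prems(5)[OF j]]
    have "(\<integral>\<^sup>+y. ?f (x(j := y)) \<partial>Q j) = ennreal (\<integral>y. tr_exp N (\<lambda>a b. K a b + R j y a b) \<partial>Q j)"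
      unfolding f using step(1) insert.prems(2)[OF j]
      by (intro nn_integral_eq_integral AE_I2 tr_exp_nonneg herm_add K) auto
    also have "\<dots> \<le> ennreal (tr_exp N (\<lambda>a b. K a b + G j a b))"
      using step(2) by (rule ennreal_leI)
    also have "(\<lambda>a b. K a b + G j a b) = (\<lambda>a b. (H a b + G j a b) + (\<Sum>i\<in>I. R i (x i) a b))"
      by (simp add: K_def add_ac)
    finally show "(\<integral>\<^sup>+y. ?f (x(j := y)) \<partial>Q j)
        \<le> ennreal (tr_exp N (\<lambda>a b. (H a b + G j a b) + (\<Sum>i\<in>I. R i (x i) a b)))" .
  qed
  also have "\<dots> \<le> ennreal (tr_exp N (\<lambda>a b. (H a b + G j a b) + (\<Sum>i\<in>I. G i a b)))"
    using insert.prems by (intro insert.IH herm_add) auto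
  also have "\<dots> = ennreal (tr_exp N (\<lambda>a b. H a b + (\<Sum>i\<in>insert j I. G i a b)))"
    using insert.hyps by (simp add: add_ac)
  finally show ?case .
qed

section \<open>Moment generating functions\<close>

lemma mexp_ge_one_plus:
  assumes "herm N G"
  shows "Re (ip N v v) + qf N G v \<le> qf N (mexp N G) v"
proof -
  let ?w = "\<lambda>i. (cmod (ip N (evecs N G i) v))\<^sup>2"
  have "qf N G v = qf N (hfun N (\<lambda>x. x) (eigs N G) (evecs N G)) v"
    by (rule qf_cong) (rule herm_hfun_eigs[OF assms])
  then have "Re (ip N v v) + qf N G v = (\<Sum>i<N. (1 + eigs N G i) * ?w i)"
    by (simp add: parseval_norm[OF onb_evecs[OF assms]] qf_hfun distrib_right sum.distrib)
  also have "\<dots> \<le> (\<Sum>i<N. exp (eigs N G i) * ?w i)"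
    by (intro sum_mono mult_right_mono exp_ge_add_one_self) simp
  finally show ?thesis
    by (simp add: qf_mexp)
qed

lemma qf_mpow:
  assumes "herm N B"
  shows "qf N (mpow N B k) v = (\<Sum>i<N. eigs N B i ^ k * (cmod (ip N (evecs N B i) v))\<^sup>2)"
proof -
  have "qf N (mpow N B k) v = qf N (hfun N (\<lambda>x. x ^ k) (eigs N B) (evecs N B)) v"
    by (rule qf_cong) (rule spec_mpow[OF spec_eigs[OF assms]])
  then show ?thesis
    by (simp add: qf_hfun)
qed

lemma qf_mpow_0: "qf N (mpow N B 0) v = Re (ip N v v)"
  by (simp add: qf_def mv_def ip_def if_distrib if_distribR cong: if_cong)

text \<open>Bounding by cosh leaves only even powers on the right. These are nonnegative, so upper
  bounds on their expectations control them absolutely.\<close>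

lemma sum_abs_exp_terms_le_cosh:
  fixes x :: real
  shows "(\<Sum>k<n. \<bar>x ^ k / fact k\<bar>) \<le> 2 * cosh x"
proof -
  have eq: "\<bar>x ^ k / fact k\<bar> = \<bar>x\<bar> ^ k /\<^sub>R fact k" for k
    by (simp add: divide_inverse_commute abs_mult power_abs)
  have "(\<Sum>k<n. \<bar>x\<bar> ^ k /\<^sub>R fact k) \<le> (\<Sum>k. \<bar>x\<bar> ^ k /\<^sub>R fact k)"
    using exp_converges[of "\<bar>x\<bar>"] by (intro sum_le_suminf) (auto simp: sums_iff)
  also have "\<dots> = exp \<bar>x\<bar>"
    using exp_converges[of "\<bar>x\<bar>"] by (simp add: sums_iff)
  also have "\<dots> \<le> exp x + exp (- x)"
    by (simp add: abs_if)
  finally show ?thesis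
    unfolding eq by (simp add: cosh_field_def)
qed

text \<open>The exponent \<open>k - 2\<close> truncates for k < 2; shifting the index by 2 leaves a
  true geometric series.\<close>

lemma summable_geometric_shift:
  fixes \<tau> c :: real
  assumes "0 \<le> \<tau>" "\<tau> < 1"
  shows "summable (\<lambda>k. \<tau> ^ (k - 2) * c)"
proof -
  have "summable (\<lambda>k. \<tau> ^ ((k + 2) - 2) * c)"
    using assms by (simp add: summable_mult2 summable_geometric)
  then show ?thesis
    by (subst (asm) summable_iff_shift)
qed

text \<open>The series of even powers has an integrable sum by the moment bounds and dominates all
  partial sums of the exponential. Dominated convergence then gives the expectation as the limit of
  the truncated moment sums, which are bounded termwise by a geometric series.\<close>

lemma mgf_bound:
  assumes M: "prob_space M"
    and R: "\<And>x. x \<in> space M \<Longrightarrow> herm N (R x)"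
    and meas: "\<And>a b. a < N \<Longrightarrow> b < N \<Longrightarrow> (\<lambda>x. R x a b) \<in> borel_measurable M"
    and int: "\<And>k a b. k \<ge> 1 \<Longrightarrow> a < N \<Longrightarrow> b < N \<Longrightarrow> integrable M (\<lambda>x. mpow N (R x) k a b)"
    and mean: "(\<integral>x. qf N (mpow N (R x) 1) v \<partial>M) = 0"
    and mom: "\<And>k. k \<ge> 2 \<Longrightarrow> (\<integral>x. qf N (mpow N (R x) k) v \<partial>M) \<le> fact k * \<tau> ^ (k - 2) / 2 * q"
    and \<tau>: "0 \<le> \<tau>" "\<tau> < 1"
  shows "integrable M (\<lambda>x. qf N (mexp N (R x)) v)"
    and "(\<integral>x. qf N (mexp N (R x)) v \<partial>M) \<le> Re (ip N v v) + q / (2 * (1 - \<tau>))"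
proof -
  interpret prob_space M by fact
  define w where "w x i = (cmod (ip N (evecs N (R x) i) v))\<^sup>2" for x i
  define e where "e x = eigs N (R x)" for x
  have w_nonneg: "w x i \<ge> 0" for x i
    by (simp add: w_def)
  have qf_pow: "qf N (mpow N (R x) k) v = (\<Sum>i<N. e x i ^ k * w x i)" if "x \<in> space M" for x k
    unfolding e_def w_def by (rule qf_mpow[OF R[OF that]])
  have int_qf: "integrable M (\<lambda>x. qf N (mpow N (R x) k) v)" for k
  proof (cases "k = 0")
    case True
    then show ?thesis
      by (simp add: qf_mpow_0 del: mpow.simps)
  next
    case False
    then show ?thesis
      by (intro integral_qf(1) int) auto
  qed
  \<comment> \<open>Terms of the cosh series in the quadratic form at \<open>v\<close>.\<close>
  define c where "c k x = (if even k then qf N (mpow N (R x) k) v / fact k else 0)" for k x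
  have c_sums: "(\<lambda>k. c k x) sums (\<Sum>i<N. cosh (e x i) * w x i)" if x: "x \<in> space M" for x
  proof -
    have "(\<lambda>k. \<Sum>i<N. (if even k then e x i ^ k /\<^sub>R fact k else 0) * w x i) sums (\<Sum>i<N. cosh (e x i) * w x i)"
      by (intro sums_sum sums_mult2 cosh_converges)
    also have "(\<lambda>k. \<Sum>i<N. (if even k then e x i ^ k /\<^sub>R fact k else 0) * w x i) = (\<lambda>k. c k x)"
      by (auto simp: c_def qf_pow[OF x] sum_divide_distrib field_simps)
    finally show ?thesis .
  qed
  have c_nonneg: "c k x \<ge> 0" if "x \<in> space M" for k x
    using w_nonneg by (auto simp: c_def qf_pow[OF that] zero_le_even_power intro!: sum_nonneg divide_nonneg_pos)
  have c_int: "integrable M (c k)" for k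
    unfolding c_def using int_qf by (cases "even k") auto
  have "integrable M (\<lambda>x. \<Sum>k. c k x)"
  proof (rule integrable_suminf[OF c_int])
    show "AE x in M. summable (\<lambda>k. norm (c k x))"
      using c_sums c_nonneg by (intro AE_I2) (auto simp: sums_iff)
    show "summable (\<lambda>k. \<integral>x. norm (c k x) \<partial>M)"
    proof (rule summable_comparison_test')
      show "summable (\<lambda>k. \<tau> ^ (k - 2) * (\<bar>q\<bar> / 2))"
        by (rule summable_geometric_shift[OF \<tau>])
      fix k :: nat assume k: "k \<ge> 2"
      have "(\<integral>x. norm (c k x) \<partial>M) = (\<integral>x. c k x \<partial>M)"
        using c_nonneg by (intro Bochner_Integration.integral_cong) auto
      also have "\<dots> \<le> \<tau> ^ (k - 2) * (\<bar>q\<bar> / 2)"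
      proof (cases "even k")
        case True
        have "(\<integral>x. c k x \<partial>M) = (\<integral>x. qf N (mpow N (R x) k) v \<partial>M) / fact k"
          using True by (simp add: c_def)
        also have "\<dots> \<le> (fact k * \<tau> ^ (k - 2) / 2 * q) / fact k"
          by (intro divide_right_mono mom[OF k]) simp
        also have "\<dots> = \<tau> ^ (k - 2) * (q / 2)"
          by simp
        also have "\<dots> \<le> \<tau> ^ (k - 2) * (\<bar>q\<bar> / 2)"
          using \<tau> by (intro mult_left_mono) auto
        finally show ?thesis .
      qed (use \<tau> in \<open>simp add: c_def\<close>)
      finally have "(\<integral>x. norm (c k x) \<partial>M) \<le> \<tau> ^ (k - 2) * (\<bar>q\<bar> / 2)" .
      then show "norm (\<integral>x. norm (c k x) \<partial>M) \<le> \<tau> ^ (k - 2) * (\<bar>q\<bar> / 2)"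
        by simp
    qed
  qed
  then have int_c: "integrable M (\<lambda>x. 2 * (\<Sum>k. c k x))"
    by simp
  define s where "s n x = (\<Sum>k<n. qf N (mpow N (R x) k) v / fact k)" for n x
  have s_lim: "(\<lambda>n. s n x) \<longlonglongrightarrow> qf N (mexp N (R x)) v" if x: "x \<in> space M" for x
  proof -
    have "(\<lambda>k. \<Sum>i<N. (e x i ^ k /\<^sub>R fact k) * w x i) sums (\<Sum>i<N. exp (e x i) * w x i)"
      by (intro sums_sum sums_mult2 exp_converges)
    also have "(\<lambda>k. \<Sum>i<N. (e x i ^ k /\<^sub>R fact k) * w x i) = (\<lambda>k. qf N (mpow N (R x) k) v / fact k)"
      by (auto simp: qf_pow[OF x] sum_divide_distrib field_simps)
    finally show ?thesis
      by (simp add: sums_def s_def qf_mexp e_def w_def)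
  qed
  have s_bound: "norm (s n x) \<le> 2 * (\<Sum>k. c k x)" if x: "x \<in> space M" for n x
  proof -
    have "s n x = (\<Sum>k<n. \<Sum>i<N. e x i ^ k / fact k * w x i)"
      by (simp add: s_def qf_pow[OF x] sum_divide_distrib)
    also have "\<dots> = (\<Sum>i<N. \<Sum>k<n. e x i ^ k / fact k * w x i)"
      by (rule sum.swap)
    also have "\<dots> = (\<Sum>i<N. (\<Sum>k<n. e x i ^ k / fact k) * w x i)"
      by (simp add: sum_distrib_right)
    finally have "norm (s n x) \<le> (\<Sum>i<N. norm ((\<Sum>k<n. e x i ^ k / fact k) * w x i))"
      by (simp only: norm_sum)
    also have "\<dots> \<le> (\<Sum>i<N. (2 * cosh (e x i)) * w x i)"
    proof (rule sum_mono)
      fix i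
      have "\<bar>\<Sum>k<n. e x i ^ k / fact k\<bar> \<le> 2 * cosh (e x i)"
        by (rule order_trans[OF sum_abs sum_abs_exp_terms_le_cosh])
      then show "norm ((\<Sum>k<n. e x i ^ k / fact k) * w x i) \<le> (2 * cosh (e x i)) * w x i"
        using w_nonneg[of x i] by (simp add: abs_mult mult_right_mono)
    qed
    also have "\<dots> = 2 * (\<Sum>k. c k x)"
      using c_sums[OF x] by (simp add: sums_iff sum_distrib_left mult.assoc)
    finally show ?thesis .
  qed
  have s_int: "integrable M (s n)" for n
    unfolding s_def using int_qf by auto
  have meas_exp: "(\<lambda>x. qf N (mexp N (R x)) v) \<in> borel_measurable M"
    by (rule borel_measurable_LIMSEQ_metric[OF borel_measurable_integrable[OF s_int] s_lim])
  have dc: "AE x in M. (\<lambda>n. s n x) \<longlonglongrightarrow> qf N (mexp N (R x)) v" "\<And>n. AE x in M. norm (s n x) \<le> 2 * (\<Sum>k. c k x)"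
    using s_lim s_bound by (auto intro!: AE_I2)
  show "integrable M (\<lambda>x. qf N (mexp N (R x)) v)"
    by (rule integrable_dominated_convergence[OF meas_exp borel_measurable_integrable[OF s_int] int_c dc])
  have lim: "(\<lambda>n. integral\<^sup>L M (s n)) \<longlonglongrightarrow> (\<integral>x. qf N (mexp N (R x)) v \<partial>M)"
    by (rule integral_dominated_convergence[OF meas_exp borel_measurable_integrable[OF s_int] int_c dc])
  \<comment> \<open>Upper bounds for the terms of the expected series: the norm term, the vanishing
    mean, and a geometric tail with sum q / (2 (1 - \<tau>)).\<close>
  define d where "d k = (if k = 0 then Re (ip N v v) else if k = 1 then 0 else \<tau> ^ (k - 2) * (q / 2))" for k :: nat
  have "(\<integral>x. qf N (mpow N (R x) k) v / fact k \<partial>M) \<le> d k" for k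
  proof -
    consider "k = 0" | "k = 1" | "k \<ge> 2"
      by linarith
    then show ?thesis
    proof cases
      case 1
      then show ?thesis
        using prob_space by (simp add: d_def qf_mpow_0 del: mpow.simps)
    next
      case 2
      then show ?thesis
        using mean by (simp add: d_def del: mpow.simps)
    next
      case 3
      have "(\<integral>x. qf N (mpow N (R x) k) v / fact k \<partial>M) = (\<integral>x. qf N (mpow N (R x) k) v \<partial>M) / fact k"
        by simp
      also have "\<dots> \<le> (fact k * \<tau> ^ (k - 2) / 2 * q) / fact k"
        by (intro divide_right_mono mom[OF 3]) simp
      also have "\<dots> = d k"
        using 3 by (simp add: d_def)
      finally show ?thesis .
    qed
  qed
  then have "integral\<^sup>L M (s n) \<le> (\<Sum>k<n. d k)" for n
    unfolding s_def using int_qf by (subst Bochner_Integration.integral_sum) (auto intro!: sum_mono)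
  moreover have "d sums (Re (ip N v v) + q / (2 * (1 - \<tau>)))"
  proof -
    have "(\<lambda>k. \<tau> ^ k * (q / 2)) sums (1 / (1 - \<tau>) * (q / 2))"
      using \<tau> by (intro sums_mult2 geometric_sums) auto
    also have "(\<lambda>k. \<tau> ^ k * (q / 2)) = (\<lambda>k. d (k + 2))"
      by (simp add: d_def)
    finally have "d sums (1 / (1 - \<tau>) * (q / 2) + (\<Sum>k<2. d k))"
      by (subst (asm) sums_iff_shift)
    also have "(\<Sum>k<2. d k) = Re (ip N v v)"
      by (simp add: d_def numeral_2_eq_2)
    finally show ?thesis
      using \<tau> by (simp add: field_simps)
  qed
  ultimately show "(\<integral>x. qf N (mexp N (R x)) v \<partial>M) \<le> Re (ip N v v) + q / (2 * (1 - \<tau>))"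
    unfolding sums_def by (intro LIMSEQ_le[OF lim]) auto
qed

section \<open>Block circulant matrices\<close>

text \<open>The block circulant matrix as a function of two indices. For valid indices s div m < p,
  so the added \<open>p\<close> keeps the natural subtraction from truncating.\<close>

definition bm :: "nat \<Rightarrow> nat \<Rightarrow> tensor \<Rightarrow> cmat" where
  "bm m p A = (\<lambda>r s. A (r mod m) (s mod m) ((r div m + p - s div m) mod p))"

lemma bcirc_bm: "bcirc m m p A = mat (m * p) (m * p) (\<lambda>(r, s). bm m p A r s)"
  by (simp add: bcirc_def bm_def)

lemma index_bounds:
  fixes m p r :: nat
  assumes "r < m * p"
  shows "0 < m" "0 < p" "r mod m < m" "r div m < p"
proof -
  show m: "0 < m" "0 < p"
    using assms by (auto intro: gr0I)
  show "r mod m < m"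
    using m by simp
  show "r div m < p"
    using assms by (simp add: less_mult_imp_div_less mult.commute)
qed

text \<open>Over the integers the slice index is a genuine difference of residues, to which the
  congruence rules apply.\<close>

lemma mod_sub_eq:
  fixes a b p :: nat
  assumes "a < p" "b < p"
  shows "int ((a + p - b) mod p) = (int a - int b) mod int p"
  using assms by (simp add: of_nat_mod of_nat_diff algebra_simps) (metis add.commute add_diff_eq mod_add_self1)

lemma sum_blocks:
  fixes f :: "nat \<Rightarrow> complex"
  shows "(\<Sum>q<m * p. f q) = (\<Sum>l<p. \<Sum>t<m. f (l * m + t))"
proof (induction p)
  case (Suc p)
  have "(\<Sum>q<m * Suc p. f q) = (\<Sum>q<m * p. f q) + (\<Sum>q\<in>{m * p..<m * p + m}. f q)"
    by (subst sum.union_disjoint[symmetric]) (auto intro!: sum.cong)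
  also have "(\<Sum>q\<in>{m * p..<m * p + m}. f q) = (\<Sum>t<m. f (p * m + t))"
    by (rule sum.reindex_bij_witness[of _ "\<lambda>t. p * m + t" "\<lambda>q. q - p * m"]) (auto simp: mult.commute)
  finally show ?case
    using Suc by simp
qed simp

text \<open>The T-product is cyclic convolution of slices. Summing over the inner block index
  \<open>L\<close> is summing over the slice L - J modulo \<open>p\<close>, since translation
  permutes the residues.\<close>

lemma bm_tprod:
  assumes r: "r < m * p" and s: "s < m * p"
  shows "bm m p (tprod m p A B) r s = mmul (m * p) (bm m p A) (bm m p B) r s"
proof -
  define I where "I = r div m"
  define J where "J = s div m"
  define i where "i = r mod m"
  define j where "j = s mod m"
  note b = index_bounds[OF r] index_bounds[OF s]
  have IJ: "I < p" "J < p" "0 < p" "0 < m"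
    using b by (simp_all add: I_def J_def)
  \<comment> \<open>The \<open>l\<close>-th term of the T-product entry in slice I - J modulo
    \<open>p\<close>.\<close>
  define h where "h l = (\<Sum>t<m. A i t (((I + p - J) mod p + p - l) mod p) * B t j l)" for l
  have "mmul (m * p) (bm m p A) (bm m p B) r s
      = (\<Sum>L<p. \<Sum>t<m. A i t ((I + p - L) mod p) * B t j ((L + p - J) mod p))"
    unfolding mmul_def sum_blocks using IJ
    by (intro sum.cong refl) (simp add: bm_def I_def J_def i_def j_def)
  also have "\<dots> = (\<Sum>L<p. h ((L + p - J) mod p))"
  proof (rule sum.cong[OF refl])
    fix L assume "L \<in> {..<p}"
    then have L: "L < p" by simp
    have "int (((I + p - J) mod p + p - (L + p - J) mod p) mod p) = int ((I + p - L) mod p)"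
      using IJ L by (simp add: mod_sub_eq mod_diff_eq)
    then have "((I + p - J) mod p + p - (L + p - J) mod p) mod p = (I + p - L) mod p"
      by linarith
    then show "(\<Sum>t<m. A i t ((I + p - L) mod p) * B t j ((L + p - J) mod p)) = h ((L + p - J) mod p)"
      by (simp add: h_def)
  qed
  also have "\<dots> = (\<Sum>l<p. h l)"
  proof (rule sum.reindex_bij_betw)
    have inj: "inj_on (\<lambda>L. (L + p - J) mod p) {..<p}"
    proof (rule inj_onI)
      fix x y assume xy: "x \<in> {..<p}" "y \<in> {..<p}" "(x + p - J) mod p = (y + p - J) mod p"
      then have "(int x - int J) mod int p = (int y - int J) mod int p"
        using IJ mod_sub_eq[of x p J] mod_sub_eq[of y p J] by simp
      then have "(int x - int J + int J) mod int p = (int y - int J + int J) mod int p"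
        by (rule mod_add_cong) simp
      then show "x = y"
        using xy by simp
    qed
    then have "(\<lambda>L. (L + p - J) mod p) ` {..<p} = {..<p}"
      using IJ by (intro endo_inj_surj) auto
    with inj show "bij_betw (\<lambda>L. (L + p - J) mod p) {..<p} {..<p}"
      by (simp add: bij_betw_def)
  qed
  also have "\<dots> = bm m p (tprod m p A B) r s"
    by (simp add: h_def bm_def tprod_def I_def J_def i_def j_def)
  finally show ?thesis ..
qed

lemma bm_tid:
  assumes r: "r < m * p" and s: "s < m * p"
  shows "bm m p tid r s = (if r = s then 1 else 0)"
proof -
  note b = index_bounds[OF r] index_bounds[OF s]
  have "(r div m + p - s div m) mod p = 0 \<longleftrightarrow> r div m = s div m"
  proof
    assume "(r div m + p - s div m) mod p = 0"
    then have "(int (r div m) - int (s div m)) mod int p = 0"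
      using mod_sub_eq[OF b(4) b(8)] by simp
    then have "int (r div m) mod int p = int (s div m) mod int p"
      by (simp add: mod_eq_dvd_iff mod_eq_0_iff_dvd)
    then show "r div m = s div m"
      using b by simp
  qed simp
  moreover have "r = s \<longleftrightarrow> r mod m = s mod m \<and> r div m = s div m"
    by (metis div_mult_mod_eq)
  ultimately show ?thesis
    by (auto simp: bm_def tid_def)
qed

lemma bm_tpow:
  "r < m * p \<Longrightarrow> s < m * p \<Longrightarrow> bm m p (tpow m p A k) r s = mpow (m * p) (bm m p A) k r s"
proof (induction k arbitrary: r)
  case 0
  then show ?case by (simp add: bm_tid)
next
  case (Suc k)
  then show ?case
    by (simp add: bm_tprod mmul_def)
qed

text \<open>Reversing the slices negates the slice index modulo \<open>p\<close>, just as exchanging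
  block row and block column negates their difference.\<close>

lemma herm_bm:
  assumes "thermitian m p A"
  shows "herm (m * p) (bm m p A)"
proof (rule hermI)
  fix r s assume r: "r < m * p" and s: "s < m * p"
  note b = index_bounds[OF r] index_bounds[OF s]
  define k where "k = (s div m + p - r div m) mod p"
  have "k < p"
    using b by (simp add: k_def)
  then have "A (s mod m) (r mod m) k = cnj (A (r mod m) (s mod m) ((p - k) mod p))"
    using assms b by (simp add: thermitian_def tconj_def)
  also have "(p - k) mod p = (r div m + p - s div m) mod p"
  proof -
    have "int ((p - k) mod p) = (- int k) mod int p"
      using \<open>k < p\<close> mod_sub_eq[of 0 p k] b by simp
    also have "\<dots> = (int (r div m) - int (s div m)) mod int p"
      unfolding k_def mod_sub_eq[OF b(8) b(4)] by (simp add: mod_minus_eq)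
    also have "\<dots> = int ((r div m + p - s div m) mod p)"
      by (rule mod_sub_eq[OF b(4) b(8), symmetric])
    finally show ?thesis
      by linarith
  qed
  finally show "cnj (bm m p A r s) = bm m p A s r"
    by (simp add: bm_def k_def)
qed

section \<open>Eigenvalues, spectral norm and Loewner order of block circulant matrices\<close>

lemma eigenvalue_mat_iff:
  "eigenvalue (mat N N (\<lambda>(r, s). F r s)) z \<longleftrightarrow>
     (\<exists>v. (\<exists>a<N. v a \<noteq> 0) \<and> (\<forall>a<N. mv N F v a = z * v a))" (is "eigenvalue ?B z \<longleftrightarrow> ?R")
proof
  assume "eigenvalue ?B z"
  then obtain v where v: "v \<in> carrier_vec N" "v \<noteq> 0\<^sub>v N" "?B *\<^sub>v v = z \<cdot>\<^sub>v v"
    by (auto simp: eigenvalue_def eigenvector_def)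
  have "\<exists>a<N. v $ a \<noteq> 0"
    using v(1,2) by (metis carrier_vecD eq_vecI index_zero_vec)
  moreover have "mv N F (($) v) a = z * v $ a" if "a < N" for a
    using arg_cong[OF v(3), of "\<lambda>w. w $ a"] that v(1)
    by (simp add: mv_def scalar_prod_def lessThan_atLeast0)
  ultimately show ?R
    by (intro exI[of _ "($) v"]) auto
next
  assume ?R
  then obtain v a where v: "a < N" "v a \<noteq> 0" "\<And>a. a < N \<Longrightarrow> mv N F v a = z * v a"
    by blast
  have "vec N v \<noteq> 0\<^sub>v N"
    using v(1,2) by (metis index_vec index_zero_vec(1))
  moreover have "?B *\<^sub>v vec N v = z \<cdot>\<^sub>v vec N v"
    using v(3) by (intro eq_vecI) (auto simp: mv_def scalar_prod_def lessThan_atLeast0)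
  ultimately show "eigenvalue ?B z"
    unfolding eigenvalue_def eigenvector_def by (intro exI[of _ "vec N v"]) simp
qed

text \<open>By completeness \<open>v\<close> has a nonzero component along some basis eigenvector;
  moving \<open>F\<close> across the inner product with it identifies \<open>z\<close> with the
  eigenvalue belonging to that vector.\<close>

lemma herm_eigenvector:
  assumes F: "herm N F" and v: "\<exists>a<N. v a \<noteq> 0" "\<forall>a<N. mv N F v a = z * v a"
  shows "\<exists>i<N. z = of_real (eigs N F i)"
proof -
  let ?u = "evecs N F" and ?l = "eigs N F"
  have "\<exists>i<N. ip N (?u i) v \<noteq> 0"
  proof (rule ccontr)
    assume "\<not> ?thesis"
    then have "v a = 0" if "a < N" for a
      using onb_expand[OF onb_evecs[OF F] that, of v] by simp
    then show False
      using v(1) by blast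
  qed
  then obtain i where i: "i < N" "ip N (?u i) v \<noteq> 0"
    by blast
  have "z * ip N (?u i) v = ip N (?u i) (mv N F v)"
    unfolding ip_scale_right[symmetric] using v(2) by (intro ip_cong) auto
  also have "\<dots> = ip N (mv N F (?u i)) v"
    by (rule herm_ip[OF F])
  also have "\<dots> = ip N (\<lambda>a. of_real (?l i) * ?u i a) v"
    using spec_eigs[OF F] i(1) by (intro ip_cong) (auto simp: spec_def)
  also have "\<dots> = of_real (?l i) * ip N (?u i) v"
    by (simp add: ip_scale_left)
  finally show ?thesis
    using i by auto
qed

lemma evecs_nonzero:
  assumes "herm N F" "i < N"
  shows "\<exists>a<N. evecs N F i a \<noteq> 0"
proof (rule ccontr)
  assume "\<not> ?thesis"
  then have "ip N (evecs N F i) (evecs N F i) = 0"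
    by (simp add: ip_def)
  then show False
    using onbD[OF onb_evecs[OF assms(1)] assms(2,2)] by simp
qed

lemma herm_eigenvalues:
  assumes "herm N F"
  shows "{z. eigenvalue (mat N N (\<lambda>(r, s). F r s)) z} = (\<lambda>i. complex_of_real (eigs N F i)) ` {..<N}"
proof (intro Set.set_eqI iffI)
  fix z assume "z \<in> {z. eigenvalue (mat N N (\<lambda>(r, s). F r s)) z}"
  then obtain v where "\<exists>a<N. v a \<noteq> 0" "\<forall>a<N. mv N F v a = z * v a"
    unfolding mem_Collect_eq eigenvalue_mat_iff by blast
  from herm_eigenvector[OF assms this] show "z \<in> (\<lambda>i. complex_of_real (eigs N F i)) ` {..<N}"
    by auto
next
  fix z assume "z \<in> (\<lambda>i. complex_of_real (eigs N F i)) ` {..<N}"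
  then obtain i where i: "i < N" "z = of_real (eigs N F i)"
    by auto
  show "z \<in> {z. eigenvalue (mat N N (\<lambda>(r, s). F r s)) z}"
    unfolding mem_Collect_eq eigenvalue_mat_iff i(2)
    using evecs_nonzero[OF assms i(1)] mv_evecs[OF assms i(1)] by (intro exI[of _ "evecs N F i"]) simp
qed

lemma lambda_max_eigs:
  assumes "herm (m * p) (bm m p A)"
  shows "lambda_max m p A = Max (eigs (m * p) (bm m p A) ` {..<m * p})"
  by (simp add: lambda_max_def bcirc_bm herm_eigenvalues[OF assms] image_image)

text \<open>The order of the eigenvalues is an arbitrary choice made separately for each matrix, so
  scaling preserves them only up to a change of index.\<close>

lemma eigs_scale:
  assumes F: "herm N F" and i: "i < N"
  shows "\<exists>k<N. eigs N (\<lambda>a b. of_real t * F a b) k = t * eigs N F i"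
proof -
  have "herm N (\<lambda>a b. of_real t * F a b)"
    by (rule hermI) (simp add: hermD[OF F])
  moreover have "\<forall>a<N. mv N (\<lambda>a b. of_real t * F a b) (evecs N F i) a = of_real (t * eigs N F i) * evecs N F i a"
    using mv_evecs[OF F i] by (simp add: mv_def sum_distrib_left[symmetric] mult.assoc)
  ultimately obtain k where "k < N" "complex_of_real (t * eigs N F i) = of_real (eigs N (\<lambda>a b. of_real t * F a b) k)"
    using herm_eigenvector evecs_nonzero[OF F i] by blast
  then show ?thesis
    unfolding of_real_eq_iff by metis
qed

text \<open>An eigenvector of a Hermitian F for the eigenvalue l is an eigenvector of F* F for l^2,
  so l^2 is at most the maximum under the square root in \<open>tnorm\<close>.\<close>

lemma eigs_le_tnorm:
  assumes F: "herm (m * p) (bm m p A)" and i: "i < m * p"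
  shows "\<bar>eigs (m * p) (bm m p A) i\<bar> \<le> tnorm m m p A"
proof -
  let ?N = "m * p" and ?F = "bm m p A"
  let ?P = "mmul ?N (adj ?F) ?F" and ?l = "eigs (m * p) (bm m p A) i" and ?u = "evecs ?N ?F i"
  have P: "herm ?N ?P"
    by (rule hermI) (simp add: mmul_def adj_def mult.commute)
  have mat: "mat_ctrans (bcirc m m p A) * bcirc m m p A = mat ?N ?N (\<lambda>(r, s). ?P r s)"
    by (rule eq_matI) (simp_all add: mat_ctrans_def bcirc_bm mmul_def adj_def scalar_prod_def lessThan_atLeast0)
  have "\<forall>a<?N. mv ?N ?P ?u a = of_real (?l\<^sup>2) * ?u a"
  proof (intro allI impI)
    fix a assume a: "a < ?N"
    have "mv ?N ?P ?u a = mv ?N (adj ?F) (mv ?N ?F ?u) a"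
      by (simp add: mv_mmul)
    also have "\<dots> = mv ?N (adj ?F) (\<lambda>b. of_real ?l * ?u b) a"
      by (rule fun_cong[OF mv_cong]) (rule mv_evecs[OF F i])
    also have "\<dots> = of_real ?l * mv ?N (adj ?F) ?u a"
      by (simp add: mv_scale_right)
    also have "mv ?N (adj ?F) ?u a = mv ?N ?F ?u a"
      using a by (simp add: mv_def adj_def hermD[OF F])
    finally show "mv ?N ?P ?u a = of_real (?l\<^sup>2) * ?u a"
      using mv_evecs[OF F i a] by (simp add: power2_eq_square)
  qed
  then have mem: "of_real (?l\<^sup>2) \<in> {z. eigenvalue (mat ?N ?N (\<lambda>(r, s). ?P r s)) z}"
    unfolding eigenvalue_mat_iff using evecs_nonzero[OF F i] by blast
  have "?l\<^sup>2 \<le> Max (Re ` {z. eigenvalue (mat ?N ?N (\<lambda>(r, s). ?P r s)) z})"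
  proof (rule Max_ge)
    show "finite (Re ` {z. eigenvalue (mat ?N ?N (\<lambda>(r, s). ?P r s)) z})"
      by (simp add: herm_eigenvalues[OF P])
    show "?l\<^sup>2 \<in> Re ` {z. eigenvalue (mat ?N ?N (\<lambda>(r, s). ?P r s)) z}"
      using imageI[OF mem, of Re] by (simp only: Re_complex_of_real)
  qed
  then have "sqrt (?l\<^sup>2) \<le> tnorm m m p A"
    unfolding tnorm_def mat by (rule real_sqrt_le_mono)
  then show ?thesis
    by simp
qed

lemma psd_qf:
  assumes "psd (bcirc m m p (tminus B A))"
  shows "qf (m * p) (bm m p A) v \<le> qf (m * p) (bm m p B) v"
proof -
  have "0 \<le> Re (\<Sum>i<m * p. \<Sum>j<m * p. cnj (v i) * bcirc m m p (tminus B A) $$ (i, j) * v j)"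
    using assms unfolding psd_def bcirc_bm by auto
  also have "(\<Sum>i<m * p. \<Sum>j<m * p. cnj (v i) * bcirc m m p (tminus B A) $$ (i, j) * v j)
      = (\<Sum>i<m * p. \<Sum>j<m * p. cnj (v i) * (bm m p B i j * v j)) - (\<Sum>i<m * p. \<Sum>j<m * p. cnj (v i) * (bm m p A i j * v j))"
    by (simp add: bcirc_bm bm_def tminus_def sum_subtractf[symmetric] algebra_simps)
  finally show ?thesis
    by (simp add: qf_def ip_def mv_def sum_distrib_left)
qed

lemma qf_scale: "qf N (\<lambda>a b. of_real c * F a b) v = c * qf N F v"
proof -
  have "ip N v (mv N (\<lambda>a b. of_real c * F a b) v) = of_real c * ip N v (mv N F v)"
    by (simp add: ip_def mv_def sum_distrib_left mult_ac)
  then show ?thesis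
    by (simp add: qf_def)
qed

lemma mpow_cong:
  "(\<And>a b. a < N \<Longrightarrow> b < N \<Longrightarrow> F a b = F' a b) \<Longrightarrow> a < N \<Longrightarrow> b < N \<Longrightarrow> mpow N F k a b = mpow N F' k a b"
  by (induction k arbitrary: a) (simp_all add: mmul_def)

lemma mpow_scale: "mpow N (\<lambda>a b. c * F a b) k a b = c ^ k * mpow N F k a b"
  by (induction k arbitrary: a) (simp_all add: mmul_def sum_distrib_left mult_ac)

lemma herm_mpow:
  assumes "herm N B"
  shows "herm N (mpow N B k)"
  by (rule hermI) (simp add: spec_mpow[OF spec_eigs[OF assms]] hermD[OF herm_hfun])

text \<open>Each eigenvalue of the scaled matrix is \<open>g\<close> times the quadratic form of
  \<open>F\<close> at a unit vector, hence at most \<open>g * s\<close>. Counting \<open>N\<close>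
  such terms is the origin of the dimensional factor in the tail bound.\<close>

lemma tr_exp_scale_le:
  assumes F: "herm N F" and g: "0 \<le> g" and le: "\<And>i. i < N \<Longrightarrow> eigs N F i \<le> s"
  shows "tr_exp N (\<lambda>a b. of_real g * F a b) \<le> real N * exp (g * s)"
proof -
  let ?G = "\<lambda>a b. of_real g * F a b"
  have G: "herm N ?G"
    by (rule hermI) (simp add: hermD[OF F])
  have "eigs N ?G k \<le> g * s" if k: "k < N" for k
  proof -
    let ?x = "evecs N ?G k"
    have "qf N F ?x = qf N (hfun N (\<lambda>x. x) (eigs N F) (evecs N F)) ?x"
      by (rule qf_cong) (rule herm_hfun_eigs[OF F])
    also have "\<dots> \<le> (\<Sum>i<N. s * (cmod (ip N (evecs N F i) ?x))\<^sup>2)"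
      unfolding qf_hfun using le by (intro sum_mono mult_right_mono) auto
    also have "\<dots> = s"
      using parseval_norm[OF onb_evecs[OF F], of ?x] onbD[OF onb_evecs[OF G] k k]
      by (simp add: sum_distrib_left[symmetric])
    finally show ?thesis
      using g by (simp add: eigs_eq_qf[OF G k] qf_scale mult_left_mono)
  qed
  then have "tr_exp N ?G \<le> (\<Sum>i<N. exp (g * s))"
    unfolding tr_exp_eigs[OF G] by (intro sum_mono) auto
  then show ?thesis
    by simp
qed

lemma herm_bm_tpow:
  assumes "thermitian m p A"
  shows "herm (m * p) (bm m p (tpow m p A k))"
  by (rule hermI) (simp add: bm_tpow hermD[OF herm_mpow[OF herm_bm[OF assms]]])


section \<open>The tail bound\<close>

text \<open>Markov's inequality is applied to exp (- t \<theta>) times the trace exponential of t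
  times the sum, which dominates the exponential of its largest eigenvalue. The parameter
  \<open>t\<close> stays free because a vanishing \<open>\<sigma>2\<close> calls for another value
  than the general case.\<close>

lemma chernoff_bound:
  fixes M :: "'a measure" and m p n :: nat and T \<theta> t :: real
    and A :: "nat \<Rightarrow> tensor" and X :: "nat \<Rightarrow> 'a \<Rightarrow> tensor"
  assumes M: "prob_space M"
    and mp: "m \<ge> 1" "p \<ge> 1" and n: "n \<ge> 1" and T: "T > 0"
    and A_herm: "\<And>i. i < n \<Longrightarrow> thermitian m p (A i)"
    and X_herm: "\<And>i \<omega>. i < n \<Longrightarrow> \<omega> \<in> space M \<Longrightarrow> thermitian m p (X i \<omega>)"
    and X_indep: "prob_space.indep_vars M (\<lambda>_. tensor_space m p)
                    (\<lambda>i \<omega>. tentries m p (X i \<omega>)) {..<n}"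
    and X_integrable: "\<And>i k a b c. i < n \<Longrightarrow> k \<ge> 1 \<Longrightarrow> a < m \<Longrightarrow> b < m \<Longrightarrow> c < p \<Longrightarrow>
                    integrable M (\<lambda>\<omega>. tpow m p (X i \<omega>) k a b c)"
    and X_mean: "\<And>i a b c. i < n \<Longrightarrow> a < m \<Longrightarrow> b < m \<Longrightarrow> c < p \<Longrightarrow> texp M (X i) a b c = tzero a b c"
    and X_moments: "\<And>i k. i < n \<Longrightarrow> k \<ge> 2 \<Longrightarrow> tle m p (texp M (\<lambda>\<omega>. tpow m p (X i \<omega>) k))
                    (tscale (complex_of_real (fact k * T ^ (k - 2) / 2)) (tpow m p (A i) 2))"
    and t: "0 < t" "t * T < 1"
  defines "\<sigma>2 \<equiv> tnorm m m p (tsum (\<lambda>i. tpow m p (A i) 2) {..<n})"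
  shows "measure M {\<omega> \<in> space M. lambda_max m p (tsum (\<lambda>i. X i \<omega>) {..<n}) \<ge> \<theta>}
           \<le> real (m * p) * exp (t\<^sup>2 * \<sigma>2 / (2 * (1 - t * T)) - t * \<theta>)"
proof -
  interpret prob_space M by fact
  define N where "N = m * p"
  have N: "N > 0"
    using mp by (simp add: N_def)
  \<comment> \<open>The sum over k \<ge> 2 of t^k T^(k-2) / 2, which is what remains of the moment
    bounds after the factorials cancel.\<close>
  define g where "g = t\<^sup>2 / (2 * (1 - t * T))"
  have g: "g \<ge> 0"
    using t by (simp add: g_def)
  define TS where "TS = tensor_space m p"
  define Y where "Y i \<omega> = tentries m p (X i \<omega>)" for i \<omega>
  define B where "B x = bm m p (\<lambda>i j k. x (i, j, k))" for x :: "nat \<times> nat \<times> nat \<Rightarrow> complex"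
  \<comment> \<open>Symmetrised, so that it is Hermitian on the whole of \<open>tensor_space\<close>.\<close>
  define W where "W x = (\<lambda>a b. of_real t * ((B x a b + cnj (B x b a)) / 2))" for x
  define S where "S i = bm m p (tpow m p (A i) 2)" for i
  define G where "G i = (\<lambda>a b. of_real g * S i a b)" for i
  have W_herm: "herm N (W x)" for x
    by (rule hermI) (simp add: W_def add.commute)
  have S_herm: "herm N (S i)" if "i < n" for i
    unfolding S_def N_def by (rule herm_bm_tpow[OF A_herm[OF that]])
  have G_herm: "herm N (G i)" if "i < n" for i
    by (rule hermI) (simp add: G_def hermD[OF S_herm[OF that]])
  have idx: "(a mod m, b mod m, (a div m + p - b div m) mod p) \<in> tidx m p" if "a < N" "b < N" for a b
    using index_bounds[of a m p] index_bounds[of b m p] that by (simp add: tidx_def N_def)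
  have B_meas: "(\<lambda>x. B x a b) \<in> borel_measurable TS" if "a < N" "b < N" for a b
    unfolding B_def bm_def TS_def tensor_space_def
    by (rule measurable_component_singleton[OF idx[OF that]])
  have W_meas: "(\<lambda>x. W x a b) \<in> borel_measurable TS" if "a < N" "b < N" for a b
  proof -
    have "cnj \<in> borel_measurable borel"
      by (intro borel_measurable_continuous_onI continuous_intros)
    from measurable_compose[OF B_meas[OF that(2,1)] this] show ?thesis
      unfolding W_def using B_meas[OF that] by simp
  qed
  have BY: "B (Y i \<omega>) a b = bm m p (X i \<omega>) a b" if "a < N" "b < N" for i \<omega> a b
    using idx[OF that] by (simp add: B_def Y_def bm_def tentries_def)
  have WY: "W (Y i \<omega>) a b = of_real t * bm m p (X i \<omega>) a b"
    if "i < n" "\<omega> \<in> space M" "a < N" "b < N" for i \<omega> a b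
  proof -
    have "cnj (bm m p (X i \<omega>) b a) = bm m p (X i \<omega>) a b"
      using herm_bm[OF X_herm[OF that(1,2)]] that by (intro hermD) (simp_all add: N_def)
    then show ?thesis
      using that by (simp add: W_def BY)
  qed
  have Y_meas: "Y i \<in> measurable M TS" if "i < n" for i
    using X_indep that unfolding indep_vars_def2 Y_def TS_def by auto
  have pow: "mpow N (W (Y i \<omega>)) k a b = of_real t ^ k * bm m p (tpow m p (X i \<omega>) k) a b"
    if "i < n" "\<omega> \<in> space M" "a < N" "b < N" for i \<omega> k a b
  proof -
    have "mpow N (W (Y i \<omega>)) k a b = mpow N (\<lambda>a b. of_real t * bm m p (X i \<omega>) a b) k a b"
      using that by (intro mpow_cong WY) auto
    then show ?thesis
      using that by (simp add: mpow_scale bm_tpow N_def)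
  qed
  have bm_int: "integrable M (\<lambda>\<omega>. bm m p (tpow m p (X i \<omega>) k) a b)"
    if "i < n" "k \<ge> 1" "a < N" "b < N" for i k a b
    unfolding bm_def using idx[OF that(3,4)] by (intro X_integrable that) (auto simp: tidx_def)
  have pow_int: "integrable M (\<lambda>\<omega>. mpow N (W (Y i \<omega>)) k a b)"
    if "i < n" "k \<ge> 1" "a < N" "b < N" for i k a b
  proof -
    have "integrable M (\<lambda>\<omega>. of_real t ^ k * bm m p (tpow m p (X i \<omega>) k) a b)"
      using bm_int[OF that] by simp
    then show ?thesis
      by (subst Bochner_Integration.integrable_cong[OF refl pow]) (use that in auto)
  qed
  have pow_qf: "(\<integral>\<omega>. qf N (mpow N (W (Y i \<omega>)) k) v \<partial>M)
      = t ^ k * qf N (bm m p (texp M (\<lambda>\<omega>. tpow m p (X i \<omega>) k))) v"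
    if "i < n" "k \<ge> 1" for i k v
  proof -
    have "(\<integral>\<omega>. qf N (mpow N (W (Y i \<omega>)) k) v \<partial>M)
        = (\<integral>\<omega>. qf N (\<lambda>a b. of_real (t ^ k) * bm m p (tpow m p (X i \<omega>) k) a b) v \<partial>M)"
      using that by (intro Bochner_Integration.integral_cong refl qf_cong) (simp add: pow)
    also have "\<dots> = t ^ k * (\<integral>\<omega>. qf N (bm m p (tpow m p (X i \<omega>) k)) v \<partial>M)"
      by (simp only: qf_scale integral_mult_right_zero)
    also have "(\<integral>\<omega>. qf N (bm m p (tpow m p (X i \<omega>) k)) v \<partial>M)
        = qf N (\<lambda>a b. \<integral>\<omega>. bm m p (tpow m p (X i \<omega>) k) a b \<partial>M) v"
      by (rule integral_qf(2)) (rule bm_int[OF that])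
    also have "(\<lambda>a b. \<integral>\<omega>. bm m p (tpow m p (X i \<omega>) k) a b \<partial>M) = bm m p (texp M (\<lambda>\<omega>. tpow m p (X i \<omega>) k))"
      by (simp add: bm_def texp_def)
    finally show ?thesis .
  qed
  have mean0: "(\<integral>\<omega>. qf N (mpow N (W (Y i \<omega>)) 1) v \<partial>M) = 0" if "i < n" for i v
  proof -
    have "bm m p (texp M (\<lambda>\<omega>. tpow m p (X i \<omega>) 1)) a b = 0" if ab: "a < N" "b < N" for a b
    proof -
      have "bm m p (texp M (\<lambda>\<omega>. tpow m p (X i \<omega>) 1)) a b = (\<integral>\<omega>. bm m p (tpow m p (X i \<omega>) 1) a b \<partial>M)"
        by (simp add: bm_def texp_def)
      also have "\<dots> = (\<integral>\<omega>. bm m p (X i \<omega>) a b \<partial>M)"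
      proof (rule Bochner_Integration.integral_cong[OF refl])
        fix \<omega>
        have "mpow N F 1 a b = F a b" for F
          using ab by (simp add: mmul_def if_distrib cong: if_cong)
        then show "bm m p (tpow m p (X i \<omega>) 1) a b = bm m p (X i \<omega>) a b"
          using ab bm_tpow[of a m p b "X i \<omega>" 1] by (simp add: N_def)
      qed
      also have "\<dots> = bm m p (texp M (X i)) a b"
        by (simp add: bm_def texp_def)
      also have "\<dots> = 0"
        using idx[OF ab] X_mean[OF \<open>i < n\<close>] by (simp add: bm_def tidx_def tzero_def)
      finally show ?thesis .
    qed
    then have "qf N (bm m p (texp M (\<lambda>\<omega>. tpow m p (X i \<omega>) 1))) v = qf N (\<lambda>a b. 0) v"
      by (rule qf_cong)
    then show ?thesis
      using pow_qf[OF that, of 1 v] by (simp add: qf_def ip_def mv_def)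
  qed
  have mom: "(\<integral>\<omega>. qf N (mpow N (W (Y i \<omega>)) k) v \<partial>M) \<le> fact k * (t * T) ^ (k - 2) / 2 * (t\<^sup>2 * qf N (S i) v)"
    if "i < n" "k \<ge> 2" for i k v
  proof -
    have "qf N (bm m p (texp M (\<lambda>\<omega>. tpow m p (X i \<omega>) k))) v
        \<le> qf N (bm m p (tscale (complex_of_real (fact k * T ^ (k - 2) / 2)) (tpow m p (A i) 2))) v"
      unfolding N_def by (rule psd_qf) (use X_moments[OF that] in \<open>simp add: tle_def\<close>)
    also have "bm m p (tscale (complex_of_real (fact k * T ^ (k - 2) / 2)) (tpow m p (A i) 2))
        = (\<lambda>a b. complex_of_real (fact k * T ^ (k - 2) / 2) * S i a b)"
      by (simp add: bm_def tscale_def S_def)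
    finally have "qf N (bm m p (texp M (\<lambda>\<omega>. tpow m p (X i \<omega>) k))) v
        \<le> fact k * T ^ (k - 2) / 2 * qf N (S i) v"
      by (simp only: qf_scale)
    then have "(\<integral>\<omega>. qf N (mpow N (W (Y i \<omega>)) k) v \<partial>M) \<le> t ^ k * (fact k * T ^ (k - 2) / 2 * qf N (S i) v)"
      using t that by (subst pow_qf) (auto intro!: mult_left_mono)
    also have "t ^ k = t ^ (k - 2) * t\<^sup>2"
      unfolding power_add[symmetric] by (simp only: le_add_diff_inverse2[OF that(2)])
    finally show ?thesis
      by (simp add: power_mult_distrib mult_ac)
  qed
  have WY_meas: "(\<lambda>\<omega>. W (Y i \<omega>) a b) \<in> borel_measurable M" if "i < n" "a < N" "b < N" for i a b
    by (rule measurable_compose[OF Y_meas W_meas]) (use that in auto)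
  have mgf_int: "integrable M (\<lambda>\<omega>. qf N (mexp N (W (Y i \<omega>))) v)"
    and mgf_le: "(\<integral>\<omega>. qf N (mexp N (W (Y i \<omega>))) v \<partial>M) \<le> qf N (mexp N (G i)) v" if "i < n" for i v
  proof -
    have tT: "0 \<le> t * T"
      using t T by simp
    note mgf = mgf_bound[where R = "\<lambda>\<omega>. W (Y i \<omega>)" and \<tau> = "t * T" and q = "t\<^sup>2 * qf N (S i) v" and v = v and N = N,
        OF M W_herm WY_meas[OF that] pow_int[OF that] mean0[OF that] mom[OF that] tT t(2)]
    show "integrable M (\<lambda>\<omega>. qf N (mexp N (W (Y i \<omega>))) v)"
      by (rule mgf(1))
    have "(\<integral>\<omega>. qf N (mexp N (W (Y i \<omega>))) v \<partial>M) \<le> Re (ip N v v) + t\<^sup>2 * qf N (S i) v / (2 * (1 - t * T))"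
      by (rule mgf(2))
    also have "\<dots> = Re (ip N v v) + qf N (G i) v"
      unfolding G_def qf_scale by (simp add: g_def)
    also have "\<dots> \<le> qf N (mexp N (G i)) v"
      by (rule mexp_ge_one_plus[OF G_herm[OF that]])
    finally show "(\<integral>\<omega>. qf N (mexp N (W (Y i \<omega>))) v \<partial>M) \<le> qf N (mexp N (G i)) v" .
  qed
  \<comment> \<open>The laws of the summands. Indices past the range repeat the law of
    \<open>Y 0\<close>, so that every \<open>Q i\<close> is a probability measure, as the product
    construction demands.\<close>
  define Q where "Q i = distr M TS (Y (if i < n then i else 0))" for i
  have Q: "prob_space (Q i)" for i
    unfolding Q_def using n by (intro prob_space_distr Y_meas) auto
  have qf_meas: "(\<lambda>x. qf N (mexp N (W x)) v) \<in> borel_measurable TS" for v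
    unfolding qf_def ip_def mv_def
    by (intro borel_measurable_Re[THEN measurable_compose[rotated]] borel_measurable_sum
        borel_measurable_times borel_measurable_const measurable_mexp W_herm W_meas) auto
  have tr_meas: "(\<lambda>x. tr_exp N (W x)) \<in> borel_measurable TS"
    by (intro measurable_tr_exp W_herm W_meas)
  have iter: "(\<integral>\<^sup>+x. ennreal (tr_exp N (\<lambda>a b. 0 + (\<Sum>i\<in>{..<n}. W (x i) a b))) \<partial>PiM {..<n} Q)
      \<le> ennreal (tr_exp N (\<lambda>a b. 0 + (\<Sum>i\<in>{..<n}. G i a b)))"
  proof (rule tr_exp_iterate[OF _ Q])
    fix i assume "i \<in> {..<n}"
    then have i: "i < n" by simp
    show "herm N (G i)"
      by (rule G_herm[OF i])
    show "herm N (W x)" for x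
      by (rule W_herm)
    show "(\<lambda>x. W x a b) \<in> borel_measurable (Q i)" if "a < N" "b < N" for a b
      unfolding Q_def using W_meas[OF that] by simp
    show "integrable (Q i) (\<lambda>x. tr_exp N (W x))"
    proof -
      have "integrable M (\<lambda>\<omega>. tr_exp N (W (Y i \<omega>)))"
        unfolding tr_exp_def mtr_qf using mgf_int[OF i] by (intro Bochner_Integration.integrable_sum)
      then show ?thesis
        unfolding Q_def using i integrable_distr_eq[OF Y_meas[OF i] tr_meas] by simp
    qed
    show "(\<integral>x. qf N (mexp N (W x)) v \<partial>Q i) \<le> qf N (mexp N (G i)) v" for v
      unfolding Q_def using i integral_distr[OF Y_meas[OF i] qf_meas] mgf_le[OF i] by simp
  qed (simp_all add: herm_def)
  \<comment> \<open>Independence in the form used here: the joint law of the tuple is the product of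
    the marginal laws.\<close>
  have PiM_eq: "PiM {..<n} Q = distr M (PiM {..<n} (\<lambda>_. TS)) (\<lambda>\<omega>. \<lambda>i\<in>{..<n}. Y i \<omega>)"
  proof -
    have "indep_vars (\<lambda>_. TS) Y {..<n}"
      using X_indep unfolding TS_def Y_def .
    then have "distr M (PiM {..<n} (\<lambda>_. TS)) (\<lambda>\<omega>. \<lambda>i\<in>{..<n}. Y i \<omega>) = PiM {..<n} (\<lambda>i. distr M TS (Y i))"
      using n by (subst indep_vars_iff_distr_eq_PiM'[symmetric]) (auto intro: Y_meas simp: lessThan_empty_iff)
    also have "\<dots> = PiM {..<n} Q"
      by (rule PiM_cong) (auto simp: Q_def)
    finally show ?thesis ..
  qed
  define Z where "Z \<omega> = tr_exp N (\<lambda>a b. \<Sum>i\<in>{..<n}. W (Y i \<omega>) a b)" for \<omega>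
  have Z_meas: "Z \<in> borel_measurable M"
    unfolding Z_def
    by (intro measurable_tr_exp herm_sum W_herm borel_measurable_sum WY_meas) auto
  have Z_distr: "(\<integral>\<^sup>+x. ennreal (tr_exp N (\<lambda>a b. \<Sum>i\<in>{..<n}. W (x i) a b)) \<partial>PiM {..<n} Q)
      = (\<integral>\<^sup>+\<omega>. ennreal (Z \<omega>) \<partial>M)"
  proof -
    have Y_tuple: "(\<lambda>\<omega>. \<lambda>i\<in>{..<n}. Y i \<omega>) \<in> measurable M (PiM {..<n} (\<lambda>_. TS))"
      by (intro measurable_restrict Y_meas) auto
    have "(\<lambda>x. ennreal (tr_exp N (\<lambda>a b. \<Sum>i\<in>{..<n}. W (x i) a b))) \<in> borel_measurable (PiM {..<n} (\<lambda>_. TS))"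
    proof (intro measurable_compose[OF _ measurable_ennreal] measurable_tr_exp herm_sum W_herm borel_measurable_sum)
      fix a b i assume ab: "a < N" "b < N" and i: "i \<in> {..<n}"
      have "(\<lambda>x. x i) \<in> measurable (PiM {..<n} (\<lambda>_. TS)) TS"
        using i by (rule measurable_component_singleton)
      from measurable_compose[OF this W_meas[OF ab]]
      show "(\<lambda>x. W (x i) a b) \<in> borel_measurable (PiM {..<n} (\<lambda>_. TS))" .
    qed
    then show ?thesis
      unfolding PiM_eq by (subst nn_integral_distr[OF Y_tuple]) (simp_all add: Z_def)
  qed
  have tr_le: "tr_exp N (\<lambda>a b. \<Sum>i\<in>{..<n}. G i a b) \<le> real N * exp (g * \<sigma>2)"
  proof -
    let ?F = "bm m p (tsum (\<lambda>i. tpow m p (A i) 2) {..<n})"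
    have F: "?F = (\<lambda>a b. \<Sum>i\<in>{..<n}. S i a b)"
      by (simp add: bm_def tsum_def S_def)
    have F_herm: "herm N ?F"
      unfolding F by (intro herm_sum S_herm) auto
    have "eigs N ?F i \<le> \<sigma>2" if "i < N" for i
      using eigs_le_tnorm[OF F_herm[unfolded N_def] that[unfolded N_def]]
      by (simp add: \<sigma>2_def N_def)
    from tr_exp_scale_le[OF F_herm g this]
    show ?thesis
      by (simp add: F G_def sum_distrib_left)
  qed
  have int_Z: "(\<integral>\<^sup>+\<omega>. ennreal (Z \<omega>) \<partial>M) \<le> ennreal (real N * exp (g * \<sigma>2))"
    using order_trans[OF iter[unfolded add_0_left Z_distr] ennreal_leI[OF tr_le]] .
  \<comment> \<open>If the largest eigenvalue reaches \<theta>, then exp (t \<theta>) is at most one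
    of the positive summands of \<open>Z\<close>.\<close>
  have sub: "{\<omega> \<in> space M. lambda_max m p (tsum (\<lambda>i. X i \<omega>) {..<n}) \<ge> \<theta>}
      \<subseteq> {\<omega> \<in> space M. 1 \<le> ennreal (exp (- t * \<theta>)) * ennreal (Z \<omega>)}"
  proof safe
    fix \<omega> assume \<omega>: "\<omega> \<in> space M" and ge: "\<theta> \<le> lambda_max m p (tsum (\<lambda>i. X i \<omega>) {..<n})"
    let ?F = "bm m p (tsum (\<lambda>i. X i \<omega>) {..<n})"
    have F: "?F = (\<lambda>a b. \<Sum>i\<in>{..<n}. bm m p (X i \<omega>) a b)"
      by (simp add: bm_def tsum_def)
    have F_herm: "herm N ?F"
      unfolding F using \<omega> by (intro herm_sum) (auto simp: N_def intro!: herm_bm X_herm)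
    have "lambda_max m p (tsum (\<lambda>i. X i \<omega>) {..<n}) = Max (eigs N ?F ` {..<N})"
      unfolding N_def by (rule lambda_max_eigs[OF F_herm[unfolded N_def]])
    moreover have "Max (eigs N ?F ` {..<N}) \<in> eigs N ?F ` {..<N}"
      using N by (intro Max_in) auto
    ultimately obtain j where j: "j < N" "\<theta> \<le> eigs N ?F j"
      using ge by auto
    obtain k where k: "k < N" "eigs N (\<lambda>a b. of_real t * ?F a b) k = t * eigs N ?F j"
      using eigs_scale[OF F_herm j(1)] by blast
    have tF_herm: "herm N (\<lambda>a b. of_real t * ?F a b)"
      by (rule hermI) (simp add: hermD[OF F_herm])
    have "exp (t * \<theta>) \<le> exp (eigs N (\<lambda>a b. of_real t * ?F a b) k)"
      using k j t by (simp add: mult_left_mono)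
    also have "\<dots> \<le> tr_exp N (\<lambda>a b. of_real t * ?F a b)"
      unfolding tr_exp_eigs[OF tF_herm] using k(1) by (intro member_le_sum) auto
    also have "\<dots> = Z \<omega>"
      unfolding Z_def tr_exp_def F
      by (intro arg_cong[where f = "mtr N"] mexp_cong) (simp add: WY \<omega> sum_distrib_left)
    finally have "1 \<le> exp (- t * \<theta>) * Z \<omega>"
      by (simp add: exp_minus field_simps)
    then show "1 \<le> ennreal (exp (- t * \<theta>)) * ennreal (Z \<omega>)"
      by (metis ennreal_1 ennreal_leI ennreal_mult' exp_ge_zero)
  qed
  have "emeasure M {\<omega> \<in> space M. 1 \<le> ennreal (exp (- t * \<theta>)) * ennreal (Z \<omega>)}
      \<le> ennreal (exp (- t * \<theta>)) * (\<integral>\<^sup>+\<omega>. ennreal (Z \<omega>) * indicator (space M) \<omega> \<partial>M)"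
    using Z_meas by (intro nn_integral_Markov_inequality) auto
  also have "(\<integral>\<^sup>+\<omega>. ennreal (Z \<omega>) * indicator (space M) \<omega> \<partial>M) = (\<integral>\<^sup>+\<omega>. ennreal (Z \<omega>) \<partial>M)"
    by (intro nn_integral_cong) simp
  also have "ennreal (exp (- t * \<theta>)) * \<dots> \<le> ennreal (exp (- t * \<theta>)) * ennreal (real N * exp (g * \<sigma>2))"
    by (intro mult_left_mono int_Z) simp
  also have "\<dots> = ennreal (real N * exp (g * \<sigma>2 - t * \<theta>))"
    by (subst ennreal_mult'[symmetric]) (simp_all add: exp_diff exp_minus field_simps)
  finally have "measure M {\<omega> \<in> space M. 1 \<le> ennreal (exp (- t * \<theta>)) * ennreal (Z \<omega>)}
      \<le> real N * exp (g * \<sigma>2 - t * \<theta>)"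
    by (simp add: emeasure_eq_measure)
  \<comment> \<open>Monotonicity asks for measurability of the larger event, which follows from that
    of \<open>Z\<close>.\<close>
  moreover have "measure M {\<omega> \<in> space M. lambda_max m p (tsum (\<lambda>i. X i \<omega>) {..<n}) \<ge> \<theta>}
      \<le> measure M {\<omega> \<in> space M. 1 \<le> ennreal (exp (- t * \<theta>)) * ennreal (Z \<omega>)}"
    using Z_meas by (intro finite_measure_mono[OF sub]) measurable
  ultimately show ?thesis
    by (simp add: N_def g_def)
qed

theorem theorem8:
  fixes M :: "'a measure" and m p n :: nat and T \<theta> :: real
    and A :: "nat \<Rightarrow> tensor" and X :: "nat \<Rightarrow> 'a \<Rightarrow> tensor"
  assumes "prob_space M"
    and "m \<ge> 1" and "p \<ge> 1" and "n \<ge> 1" and "T > 0"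
    and A_herm: "\<forall>i<n. thermitian m p (A i)"
    and X_herm: "\<forall>i<n. \<forall>\<omega>\<in>space M. thermitian m p (X i \<omega>)"
    and X_indep: "prob_space.indep_vars M (\<lambda>_. tensor_space m p)
                    (\<lambda>i \<omega>. tentries m p (X i \<omega>)) {..<n}"
    and X_integrable: "\<forall>i<n. \<forall>k\<ge>1. \<forall>a<m. \<forall>b<m. \<forall>c<p.
                    integrable M (\<lambda>\<omega>. tpow m p (X i \<omega>) k a b c)"
    and X_mean: "\<forall>i<n. \<forall>a<m. \<forall>b<m. \<forall>c<p. texp M (X i) a b c = tzero a b c"
    and X_moments: "\<forall>i<n. \<forall>k\<ge>2. tle m p (texp M (\<lambda>\<omega>. tpow m p (X i \<omega>) k))
                    (tscale (complex_of_real (fact k * T ^ (k - 2) / 2)) (tpow m p (A i) 2))"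
    and "\<theta> \<ge> 0"
  defines "\<sigma>2 \<equiv> tnorm m m p (tsum (\<lambda>i. tpow m p (A i) 2) {..<n})"
  shows "measure M {\<omega> \<in> space M. lambda_max m p (tsum (\<lambda>i. X i \<omega>) {..<n}) \<ge> \<theta>}
           \<le> real (m * p) * exp ((- \<theta>\<^sup>2 / 2) / (\<sigma>2 + T * \<theta>))
     \<and> (\<theta> \<le> \<sigma>2 / T \<longrightarrow>
         measure M {\<omega> \<in> space M. lambda_max m p (tsum (\<lambda>i. X i \<omega>) {..<n}) \<ge> \<theta>}
           \<le> real (m * p) * exp (- \<theta>\<^sup>2 / (4 * \<sigma>2)))
     \<and> (\<theta> \<ge> \<sigma>2 / T \<longrightarrow>
         measure M {\<omega> \<in> space M. lambda_max m p (tsum (\<lambda>i. X i \<omega>) {..<n}) \<ge> \<theta>}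
           \<le> real (m * p) * exp (- \<theta> / (4 * T)))"
proof -
  interpret prob_space M by fact
  let ?P = "measure M {\<omega> \<in> space M. lambda_max m p (tsum (\<lambda>i. X i \<omega>) {..<n}) \<ge> \<theta>}"
  have N: "real (m * p) \<ge> 1"
    using mult_le_mono[OF assms(2,3)] by (simp del: of_nat_mult)
  have chernoff: "?P \<le> real (m * p) * exp (t\<^sup>2 * \<sigma>2 / (2 * (1 - t * T)) - t * \<theta>)"
    if "0 < t" "t * T < 1" for t
    unfolding \<sigma>2_def using assms that by (intro chernoff_bound) auto
  \<comment> \<open>The norm dominates the modulus of the eigenvalue with index 0, which exists
    because m p \<ge> 1.\<close>
  have sig: "\<sigma>2 \<ge> 0"
  proof -
    let ?S = "tsum (\<lambda>i. tpow m p (A i) 2) {..<n}"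
    have "bm m p ?S = (\<lambda>a b. \<Sum>i<n. bm m p (tpow m p (A i) 2) a b)"
      by (simp add: bm_def tsum_def)
    then have "herm (m * p) (bm m p ?S)"
      using A_herm by (auto intro!: herm_sum herm_bm_tpow)
    from eigs_le_tnorm[OF this, of 0] show ?thesis
      using assms(2,3) unfolding \<sigma>2_def by auto
  qed
  have P1: "?P \<le> 1"
    by (rule prob_le_1)
  have main: "?P \<le> real (m * p) * exp ((- \<theta>\<^sup>2 / 2) / (\<sigma>2 + T * \<theta>))"
  \<comment> \<open>At \<theta> = 0 the general choice of t would be 0, outside the range of the
    exponential bound; here the right-hand side is m p, at least 1.\<close>
  proof (cases "\<theta> = 0")
    case True
    then show ?thesis
      using order_trans[OF P1 N] by simp
  next
    case False
    then have \<theta>: "\<theta> > 0"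
      using \<open>\<theta> \<ge> 0\<close> by simp
    show ?thesis
    \<comment> \<open>With \<open>\<sigma>2 = 0\<close> the general choice would give t T = 1. Half
      of it, t = 1 / (2 T), already reproduces the claimed exponent exactly.\<close>
    proof (cases "\<sigma>2 = 0")
      case True
      have "?P \<le> real (m * p) * exp (- (\<theta> / (2 * T)))"
        using chernoff[of "1 / (2 * T)"] \<open>T > 0\<close> True by simp
      also have "- (\<theta> / (2 * T)) = (- \<theta>\<^sup>2 / 2) / (\<sigma>2 + T * \<theta>)"
        using \<theta> \<open>T > 0\<close> True by (simp add: power2_eq_square)
      finally show ?thesis .
    next
      case False
      \<comment> \<open>With t = \<theta> / d the exponent becomes \<theta>^2 / (2 d) - \<theta>^2 /
        d, because 1 - t T = \<sigma>2 / d cancels the factor \<open>\<sigma>2\<close>.\<close>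
      define d where "d = \<sigma>2 + T * \<theta>"
      have d: "d > 0" "\<sigma>2 > 0"
        using sig False \<theta> \<open>T > 0\<close> by (simp_all add: d_def add_pos_pos)
      have 1: "1 - \<theta> / d * T = \<sigma>2 / d"
        using d by (simp add: d_def field_simps)
      have "?P \<le> real (m * p) * exp ((\<theta> / d)\<^sup>2 * \<sigma>2 / (2 * (1 - \<theta> / d * T)) - \<theta> / d * \<theta>)"
      proof (rule chernoff)
        show "0 < \<theta> / d"
          using d \<theta> by simp
        have "0 < \<sigma>2 / d"
          using d by simp
        then show "\<theta> / d * T < 1"
          using 1 by simp
      qed
      also have "(\<theta> / d)\<^sup>2 * \<sigma>2 / (2 * (1 - \<theta> / d * T)) - \<theta> / d * \<theta> = (- \<theta>\<^sup>2 / 2) / d"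
        unfolding 1 using d by (simp add: field_simps power2_eq_square)
      finally show ?thesis
        by (simp add: d_def)
    qed
  qed
  moreover have "?P \<le> real (m * p) * exp (- \<theta>\<^sup>2 / (4 * \<sigma>2))" if le: "\<theta> \<le> \<sigma>2 / T"
  \<comment> \<open>For \<open>\<sigma>2 = 0\<close> division by zero yields 0, so the right-hand
    side is m p and the bound is trivial.\<close>
  proof (cases "\<sigma>2 = 0")
    case True
    then show ?thesis
      using order_trans[OF P1 N] by simp
  next
    case False
    \<comment> \<open>In this range 2 (\<sigma>2 + T \<theta>) is at most 4 \<sigma>2.\<close>
    have T\<theta>: "T * \<theta> \<le> \<sigma>2"
      using le \<open>T > 0\<close> by (simp add: field_simps)
    have "\<theta>\<^sup>2 / (4 * \<sigma>2) \<le> \<theta>\<^sup>2 / (2 * (\<sigma>2 + T * \<theta>))"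
      using False sig T\<theta> \<open>T > 0\<close> \<open>\<theta> \<ge> 0\<close> by (intro divide_left_mono mult_pos_pos add_pos_nonneg) auto
    then have "exp ((- \<theta>\<^sup>2 / 2) / (\<sigma>2 + T * \<theta>)) \<le> exp (- \<theta>\<^sup>2 / (4 * \<sigma>2))"
      by simp
    then show ?thesis
      using main by (meson mult_left_mono of_nat_0_le_iff order_trans)
  qed
  moreover have "?P \<le> real (m * p) * exp (- \<theta> / (4 * T))" if ge: "\<theta> \<ge> \<sigma>2 / T"
  proof (cases "\<theta> = 0")
    case True
    then show ?thesis
      using order_trans[OF P1 N] by simp
  next
    case False
    \<comment> \<open>In this range 2 (\<sigma>2 + T \<theta>) is at most 4 T \<theta>, and one
      factor \<theta> cancels.\<close>
    have T\<theta>: "\<sigma>2 \<le> T * \<theta>" "0 < T * \<theta>"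
      using ge False \<open>T > 0\<close> \<open>\<theta> \<ge> 0\<close> by (simp_all add: field_simps)
    have "\<theta> / (4 * T) = \<theta>\<^sup>2 / (4 * (T * \<theta>))"
      using False by (simp add: power2_eq_square)
    also have "\<dots> \<le> \<theta>\<^sup>2 / (2 * (\<sigma>2 + T * \<theta>))"
      using sig T\<theta> False \<open>T > 0\<close> \<open>\<theta> \<ge> 0\<close>
      by (intro divide_left_mono mult_pos_pos add_nonneg_pos) auto
    finally have "exp ((- \<theta>\<^sup>2 / 2) / (\<sigma>2 + T * \<theta>)) \<le> exp (- \<theta> / (4 * T))"
      by simp
    then show ?thesis
      using main by (meson mult_left_mono of_nat_0_le_iff order_trans)
  qed
  ultimately show ?thesis
    by blast
qed

end
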